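(* Let $CD$ be the Cantor dust, $\boldsymbol{c}: CD \to \mathbb{T}^2$ the map induced by the product of two Cantor functions, $C^{\infty}(\mathbb{T}^2)$ the algebra of smooth (complex-valued) functions on the torus, and $\boldsymbol{c}^{*}C^{\infty}(\mathbb{T}^{2}) = \{\tilde f \circ \boldsymbol{c} : \tilde f \in C^\infty(\mathbb{T}^2)\} \subset C(CD)$. Let $\phi_n$ be the approximating combinatorial integration on $CD$. Then for all $f = \boldsymbol{c}^{*}(\tilde{f}) = \tilde f\circ \boldsymbol{c}$, $g = \boldsymbol{c}^{*}(\tilde{g})$, $h = \boldsymbol{c}^{*}(\tilde{h})$ with $\tilde f,\tilde g,\tilde h \in C^{\infty}(\mathbb{T}^{2})$, the limit of $\phi_n(f,g,h)$ as $n\to\infty$ exists and \[ \lim_{n \to \infty} \phi_{n}(f,g,h) = 2\int_{\mathbb{T}^{2}} \tilde{f}\, d\tilde{g} \wedge d\tilde{h}. \] Moreover, the limit depends only on $f,g,h \in \boldsymbol{c}^{*}C^{\infty}(\mathbb{T}^{2})$ (not on the choice of $\tilde f,\tilde g,\tilde h$). Therefore, the functional $\phi(f,g,h) = \lim_{n \to \infty}\phi_{n}(f,g,h)$ is a cyclic $2$-cocycle on the algebra $\boldsymbol{c}^{*}C^{\infty}(\mathbb{T}^{2})$.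
   Context: Cantor dust. Let $I=[0,1]\times[0,1]$, $S=\{1,2,3,4\}$, and let $f_s: I\to I$ be $f_1(x)=\frac13 x$, $f_2(x)=\frac13 x+\frac13(0,2)$, $f_3(x)=\frac13 x+\frac13(2,0)$, $f_4(x)=\frac13x+\frac13(2,2)$. The Cantor dust $CD$ is the unique non-empty compact subset of $I$ with $CD=\bigcup_{s=1}^4 f_s(CD)$. For $\boldsymbol{s}=(s_1,\dots,s_n)\in S^{\times n}$ put $f_{\boldsymbol{s}}=f_{s_1}\circ\cdots\circ f_{s_n}$. The square $f_{\boldsymbol{s}}(I)$ has edge length $e=3^{-n}$, and its vertices, which lie in $CD$, are numbered counterclockwise: $0$ = lower left, $1$ = lower right, $2$ = upper right, $3$ = upper left (i.e. $i$ denotes $f_{\boldsymbol{s}}(v_i)$ with $v_0=(0,0)$, $v_1=(1,0)$, $v_2=(1,1)$, $v_3=(0,1)$). Combinatorial Fredholm module. For each $\boldsymbol{s}\in S^{\times n}$ let $\mathcal{H}_{\boldsymbol{s}}=\ell^2$ of the four vertices of $f_{\boldsymbol{s}}(I)$, with the ordered basis corresponding to the vertices $(0,2,1,3)$. A function $f\in C(CD)$ acts on $\mathcal{H}_{\boldsymbol{s}}$ by multiplication, i.e. as the diagonal matrix $\mathrm{diag}(f(0),f(2),f(1),f(3))$. In the same basis put \[ F=\frac{1}{\sqrt2}\begin{bmatrix}0&0&1&1\\0&0&-1&1\\1&-1&0&0\\1&1&0&0\end{bmatrix},\qquad M=-\frac{2}{e^2}[F,x][F,y]=\begin{bmatrix}0&1&0&0\\-1&0&0&0\\0&0&0&1\\0&0&-1&0\end{bmatrix},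 \] where $x,y$ are the coordinate functions of $\mathbb{R}^2$. Approximating combinatorial integration. For $n\in\mathbb{N}$ and $f,g,h\in C(CD)$, \[ \phi_n(f,g,h)=\sum_{\boldsymbol{s}\in S^{\times n}}\operatorname{Tr}\bigl(f[F,g][F,h]M\bigr), \] where the summand indexed by $\boldsymbol{s}$ is the trace of the operator on $\mathcal{H}_{\boldsymbol{s}}$. The map $\boldsymbol{c}$. Let $c:[0,1]\to[0,1]$ be the Cantor function, i.e. the limit of the sequence $c_0(x)=x$, $c_{n+1}(x)=\frac12c_n(3x)$ on $[0,\frac13]$, $c_{n+1}(x)=\frac12$ on $[\frac13,\frac23]$, $c_{n+1}(x)=\frac12c_n(3x-2)+\frac12$ on $[\frac23,1]$. Let $\mathbb{T}^2=I/\!\sim$ with $(a,0)\sim(a,1)$, $(0,b)\sim(1,b)$ (so $\mathbb{T}^2=\mathbb{R}^2/\mathbb{Z}^2$ as a smooth manifold, oriented by $dx\wedge dy$). The continuous map $\boldsymbol{c}:CD\to\mathbb{T}^2$ is the restriction to $CD$ of $(x,y)\mapsto(c(x),c(y))$ followed by the quotient map $I\to\mathbb{T}^2$. A cyclic $2$-cocycle on an algebra $A$ is a trilinear functional $\phi$ on $A$ with $\phi(a_1,a_2,a_0)=\phi(a_0,a_1,a_2)$ and $\phi(a_0a_1,a_2,a_3)-\phi(a_0,a_1a_2,a_3)+\phi(a_0,a_1,a_2a_3)-\phi(a_3a_0,a_1,a_2)=0$ for all $a_i\in A$. *)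

theory Defs
  imports "HOL-Analysis.Analysis"
begin

abbreviation unit_square :: "(real \<times> real) set" where
  "unit_square \<equiv> {0..1} \<times> {0..1}"

definition offset :: "nat \<Rightarrow> real \<times> real" where
  "offset s = (if s = 1 then (0, 0) else if s = 2 then (0, 2) else if s = 3 then (2, 0) else (2, 2))"

definition contraction :: "nat \<Rightarrow> real \<times> real \<Rightarrow> real \<times> real" where
  "contraction s p = (1/3) *\<^sub>R p + (1/3) *\<^sub>R offset s"

definition cantor_dust :: "(real \<times> real) set" where
  "cantor_dust = (THE K. compact K \<and> K \<noteq> {} \<and> K \<subseteq> unit_square \<and>
      K = (\<Union>s\<in>{1, 2, 3, 4}. contraction s ` K))"

definition words :: "nat \<Rightarrow> nat list set" where
  "words n = {s. length s = n \<and> set s \<subseteq> {1, 2, 3, 4}}"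

definition word_map :: "nat list \<Rightarrow> real \<times> real \<Rightarrow> real \<times> real" where
  "word_map s = foldr (\<lambda>i g. contraction i \<circ> g) s id"

definition corner :: "nat \<Rightarrow> real \<times> real" where
  "corner i = (if i = 0 then (0, 0) else if i = 1 then (1, 0) else if i = 2 then (1, 1) else (0, 1))"

definition vertex :: "nat list \<Rightarrow> nat \<Rightarrow> real \<times> real" where
  "vertex s i = word_map s (corner i)"

text \<open>
  Operators on the four-dimensional space of a square are matrices with respect to the basis of
  vertices in the order 0, 2, 1, 3.
\<close>

definition mult_op :: "nat list \<Rightarrow> (real \<times> real \<Rightarrow> complex) \<Rightarrow> complex^4^4" where
  "mult_op s f = (let d = (vector [f (vertex s 0), f (vertex s 2), f (vertex s 1), f (vertex s 3)] :: complex^4)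
     in (\<chi> i j. if i = j then d $ i else 0))"

definition F_op :: "complex^4^4" where
  "F_op = (1 / sqrt 2) *\<^sub>R vector
     [vector [0,  0,  1, 1],
      vector [0,  0, -1, 1],
      vector [1, -1,  0, 0],
      vector [1,  1,  0, 0]]"

definition M_op :: "complex^4^4" where
  "M_op = vector
     [vector [ 0, 1,  0, 0],
      vector [-1, 0,  0, 0],
      vector [ 0, 0,  0, 1],
      vector [ 0, 0, -1, 0]]"

definition commutator :: "complex^4^4 \<Rightarrow> complex^4^4 \<Rightarrow> complex^4^4" where
  "commutator A B = A ** B - B ** A"

definition phi_n :: "nat \<Rightarrow> (real \<times> real \<Rightarrow> complex) \<Rightarrow> (real \<times> real \<Rightarrow> complex) \<Rightarrow> (real \<times> real \<Rightarrow> complex) \<Rightarrow> complex" where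
  "phi_n n f g h = (\<Sum>s\<in>words n.
     trace (mult_op s f ** commutator F_op (mult_op s g) ** commutator F_op (mult_op s h) ** M_op))"

definition phi :: "(real \<times> real \<Rightarrow> complex) \<Rightarrow> (real \<times> real \<Rightarrow> complex) \<Rightarrow> (real \<times> real \<Rightarrow> complex) \<Rightarrow> complex" where
  "phi f g h = lim (\<lambda>n. phi_n n f g h)"

text \<open>
  The matrix \<open>M_op\<close> is $-\frac{2}{e^2}[F,x][F,y]$, with $e$ the edge length of the square; in
  particular this does not depend on the square.
\<close>

lemma word_map_affine: "word_map s p = word_map s 0 + (1/3) ^ length s *\<^sub>R p"
  by (induction s) (simp_all add: word_map_def contraction_def algebra_simps)

lemma vector_4:
  "(vector [a, b, c, d] :: 'a::zero^4) $ 1 = a"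
  "(vector [a, b, c, d] :: 'a::zero^4) $ 2 = b"
  "(vector [a, b, c, d] :: 'a::zero^4) $ 3 = c"
  "(vector [a, b, c, d] :: 'a::zero^4) $ 4 = d"
  by (simp_all add: vector_def)

lemma M_op_eq:
  fixes s :: "nat list"
  defines "e \<equiv> (1/3 :: real) ^ length s"
  shows "M_op = (- 2 / e\<^sup>2) *\<^sub>R
    (commutator F_op (mult_op s (\<lambda>p. of_real (fst p))) **
     commutator F_op (mult_op s (\<lambda>p. of_real (snd p))))"
proof -
  obtain a b where ab: "word_map s 0 = (a, b)" by fastforce
  have v: "vertex s i = (a + e * fst (corner i), b + e * snd (corner i))" for i
    unfolding vertex_def by (subst word_map_affine) (simp add: ab e_def prod_eq_iff)
  have e: "e \<noteq> 0" by (simp add: e_def)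
  have sq: "complex_of_real (sqrt 2) * complex_of_real (sqrt 2) = 2"
    by (metis of_real_mult of_real_numeral real_sqrt_mult_self abs_numeral)
  show ?thesis
    using e sq
    apply (simp add: vec_eq_iff forall_4 M_op_def F_op_def commutator_def mult_op_def v corner_def
        vector_4 matrix_matrix_mult_def sum_4)
    apply (simp add: scaleR_conv_of_real field_simps power2_eq_square)
    done
qed

definition torus_rel :: "real \<times> real \<Rightarrow> real \<times> real \<Rightarrow> bool" where
  "torus_rel p q \<longleftrightarrow> fst p - fst q \<in> \<int> \<and> snd p - snd q \<in> \<int>"

quotient_type torus = "real \<times> real" / torus_rel
proof (rule equivpI)
  show "reflp torus_rel" by (simp add: reflp_def torus_rel_def)
  show "symp torus_rel"
    unfolding symp_def torus_rel_def by (metis Ints_minus minus_diff_eq)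
  show "transp torus_rel"
    unfolding transp_def torus_rel_def by (metis Ints_add diff_add_cancel add_diff_eq)
qed

text \<open>The quotient map \<open>abs_torus\<close> restricted to \<open>unit_square\<close> glues opposite edges.\<close>

primrec Ck :: "nat \<Rightarrow> ('a::real_normed_vector \<Rightarrow> 'b::real_normed_vector) \<Rightarrow> bool" where
  "Ck 0 F \<longleftrightarrow> continuous_on UNIV F"
| "Ck (Suc k) F \<longleftrightarrow>
     (\<forall>p. F differentiable (at p)) \<and> (\<forall>v. Ck k (\<lambda>p. frechet_derivative F (at p) v))"

text \<open>
  The smooth structure on the torus is the one for which \<open>abs_torus\<close> is a local diffeomorphism,
  so functions and forms on the torus are given by their pullbacks to the plane.
\<close>

definition smooth_torus :: "(torus \<Rightarrow> complex) set" where
  "smooth_torus = {f. \<forall>k. Ck k (f \<circ> abs_torus)}"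

definition torus_d :: "(torus \<Rightarrow> complex) \<Rightarrow> real \<times> real \<Rightarrow> real \<times> real \<Rightarrow> complex" where
  "torus_d f p v = frechet_derivative (f \<circ> abs_torus) (at p) v"

definition wedge :: "(real \<times> real \<Rightarrow> complex) \<Rightarrow> (real \<times> real \<Rightarrow> complex) \<Rightarrow> real \<times> real \<Rightarrow> real \<times> real \<Rightarrow> complex" where
  "wedge \<alpha> \<beta> u v = \<alpha> u * \<beta> v - \<alpha> v * \<beta> u"

text \<open>
  The integral over the torus of the 2-form $f\,dg\wedge dh$, oriented by $dx\wedge dy$, computed
  on the fundamental domain \<open>unit_square\<close>.
\<close>

definition torus_integral :: "(torus \<Rightarrow> complex) \<Rightarrow> (torus \<Rightarrow> complex) \<Rightarrow> (torus \<Rightarrow> complex) \<Rightarrow> complex" where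
  "torus_integral f g h = (LINT p:unit_square|lborel.
     f (abs_torus p) * wedge (torus_d g p) (torus_d h p) (1, 0) (0, 1))"

primrec cantor_approx :: "nat \<Rightarrow> real \<Rightarrow> real" where
  "cantor_approx 0 x = x"
| "cantor_approx (Suc n) x =
     (if x \<le> 1/3 then cantor_approx n (3 * x) / 2
      else if x \<le> 2/3 then 1/2
      else cantor_approx n (3 * x - 2) / 2 + 1/2)"

definition cantor_function :: "real \<Rightarrow> real" where
  "cantor_function x = lim (\<lambda>n. cantor_approx n x)"

definition cantor_map :: "real \<times> real \<Rightarrow> torus" where
  "cantor_map p = abs_torus (cantor_function (fst p), cantor_function (snd p))"

text \<open>
  Functions on the Cantor dust are represented by functions on the plane that are extensional,
  so that equality of representatives is equality on the Cantor dust.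
\<close>

definition pullback :: "(torus \<Rightarrow> complex) \<Rightarrow> real \<times> real \<Rightarrow> complex" where
  "pullback f = restrict (f \<circ> cantor_map) cantor_dust"

definition pullback_algebra :: "(real \<times> real \<Rightarrow> complex) set" where
  "pullback_algebra = pullback ` smooth_torus"

definition continuous_functions :: "'a::topological_space set \<Rightarrow> ('a \<Rightarrow> complex) set" where
  "continuous_functions X = {f \<in> extensional X. continuous_on X f}"

definition fadd :: "'a set \<Rightarrow> ('a \<Rightarrow> complex) \<Rightarrow> ('a \<Rightarrow> complex) \<Rightarrow> 'a \<Rightarrow> complex" where
  "fadd X f g = (\<lambda>x\<in>X. f x + g x)"

definition fmult :: "'a set \<Rightarrow> ('a \<Rightarrow> complex) \<Rightarrow> ('a \<Rightarrow> complex) \<Rightarrow> 'a \<Rightarrow> complex" where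
  "fmult X f g = (\<lambda>x\<in>X. f x * g x)"

definition fscale :: "'a set \<Rightarrow> complex \<Rightarrow> ('a \<Rightarrow> complex) \<Rightarrow> 'a \<Rightarrow> complex" where
  "fscale X z f = (\<lambda>x\<in>X. z * f x)"

definition subalgebra_of_continuous :: "'a::topological_space set \<Rightarrow> ('a \<Rightarrow> complex) set \<Rightarrow> bool" where
  "subalgebra_of_continuous X A \<longleftrightarrow>
     A \<subseteq> continuous_functions X \<and> (\<lambda>x\<in>X. 1) \<in> A \<and>
     (\<forall>f\<in>A. \<forall>g\<in>A. fadd X f g \<in> A \<and> fmult X f g \<in> A) \<and>
     (\<forall>z. \<forall>f\<in>A. fscale X z f \<in> A)"

definition linear_functional_on :: "'a set \<Rightarrow> ('a \<Rightarrow> complex) set \<Rightarrow> (('a \<Rightarrow> complex) \<Rightarrow> complex) \<Rightarrow> bool" where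
  "linear_functional_on X A L \<longleftrightarrow>
     (\<forall>f\<in>A. \<forall>g\<in>A. L (fadd X f g) = L f + L g) \<and>
     (\<forall>z. \<forall>f\<in>A. L (fscale X z f) = z * L f)"

definition trilinear_on :: "'a set \<Rightarrow> ('a \<Rightarrow> complex) set \<Rightarrow>
    (('a \<Rightarrow> complex) \<Rightarrow> ('a \<Rightarrow> complex) \<Rightarrow> ('a \<Rightarrow> complex) \<Rightarrow> complex) \<Rightarrow> bool" where
  "trilinear_on X A \<phi> \<longleftrightarrow>
     (\<forall>a\<in>A. \<forall>b\<in>A.
        linear_functional_on X A (\<lambda>f. \<phi> f a b) \<and>
        linear_functional_on X A (\<lambda>f. \<phi> a f b) \<and>
        linear_functional_on X A (\<lambda>f. \<phi> a b f))"

definition cyclic_2_cocycle_on :: "'a set \<Rightarrow> ('a \<Rightarrow> complex) set \<Rightarrow>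
    (('a \<Rightarrow> complex) \<Rightarrow> ('a \<Rightarrow> complex) \<Rightarrow> ('a \<Rightarrow> complex) \<Rightarrow> complex) \<Rightarrow> bool" where
  "cyclic_2_cocycle_on X A \<phi> \<longleftrightarrow>
     trilinear_on X A \<phi> \<and>
     (\<forall>a0\<in>A. \<forall>a1\<in>A. \<forall>a2\<in>A. \<phi> a1 a2 a0 = \<phi> a0 a1 a2) \<and>
     (\<forall>a0\<in>A. \<forall>a1\<in>A. \<forall>a2\<in>A. \<forall>a3\<in>A.
        \<phi> (fmult X a0 a1) a2 a3 - \<phi> a0 (fmult X a1 a2) a3
        + \<phi> a0 a1 (fmult X a2 a3) - \<phi> (fmult X a3 a0) a1 a2 = 0)"

end

theory Submission
  imports Defs
begin

text \<open>
  The Cantor function turns the ternary squares of the dust into dyadic squares: the product of two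
  Cantor functions maps the four vertices of the square of a word of length \<open>n\<close> to the four vertices
  of a dyadic square with edge \<open>2^-n\<close>, and every such square in the unit square occurs exactly once
  (\<open>cantor_pair_vertex\<close>, \<open>sum_words_dyadic_corner\<close>). As all vertices lie in the dust, \<open>phi_n\<close> of
  three pullbacks is a sum over the dyadic grid of the torus (\<open>phi_n_pullback\<close>).

  The trace on one square is an explicit form in the values at the four vertices, bilinear in the
  differences of \<open>g\<close> and \<open>h\<close> along the edges. Divided by the edge length, these differences
  become partial derivatives, and the form divided by the area becomes \<open>2 f (g_x h_y - g_y h_x)\<close>. Thus the sum is the integral of a step
  function that converges pointwise and boundedly, and dominated convergence gives
  the limit \<open>2 \<integral> f dg \<and> dh\<close> (\<open>grid_sum_tendsto\<close>). Since \<open>phi_n\<close> sees only the pullbacks, so does its limit.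

  Trilinearity passes to the limit. The Hochschild identity for \<open>f dg \<and> dh\<close> holds pointwise by the Leibniz
  rule. Cyclicity reduces, again by the Leibniz rule, to \<open>\<integral> du \<and> dh = 0\<close>. This is Stokes' theorem on the torus,
  but it has a combinatorial proof here: for \<open>f = 1\<close> the trace on a square is the shoelace formula, a sum of
  antisymmetric contributions of the oriented edges, and on the torus each edge is traversed once
  in either direction. So \<open>phi_n\<close> of \<open>1, u, h\<close> vanishes for every \<open>n\<close> (\<open>grid_sum_one_periodic\<close>), and hence so does the
  integral (\<open>torus_integral_exact\<close>).
\<close>

section \<open>The Cantor function\<close>

lemma cantor_approx_0: "cantor_approx n 0 = 0"
  by (induction n) auto

lemma cantor_approx_1: "cantor_approx n 1 = 1"
  by (induction n) auto

text \<open>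
  The recursion rescales to one third and halves the values, so it halves the distance between
  consecutive approximations; this makes their convergence uniform.
\<close>

lemma cantor_approx_step:
  "x \<in> {0..1} \<Longrightarrow> \<bar>cantor_approx (Suc n) x - cantor_approx n x\<bar> \<le> (1/2) ^ n"
proof (induction n arbitrary: x)
  case 0
  then show ?case by (auto simp: abs_le_iff field_simps)
next
  case (Suc n)
  consider "x \<le> 1/3" | "1/3 < x" "x \<le> 2/3" | "2/3 < x" by linarith
  then show ?case
  proof cases
    case 1
    then have "\<bar>cantor_approx (Suc n) (3 * x) - cantor_approx n (3 * x)\<bar> \<le> (1/2) ^ n"
      using Suc.prems by (intro Suc.IH) auto
    moreover have "cantor_approx (Suc (Suc n)) x = cantor_approx (Suc n) (3 * x) / 2"
      "cantor_approx (Suc n) x = cantor_approx n (3 * x) / 2"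
      using 1 by simp_all
    ultimately show ?thesis
      unfolding power_Suc by linarith
  next
    case 2
    then show ?thesis by simp
  next
    case 3
    then have "\<bar>cantor_approx (Suc n) (3 * x - 2) - cantor_approx n (3 * x - 2)\<bar> \<le> (1/2) ^ n"
      using Suc.prems by (intro Suc.IH) auto
    moreover have "cantor_approx (Suc (Suc n)) x = cantor_approx (Suc n) (3 * x - 2) / 2 + 1/2"
      "cantor_approx (Suc n) x = cantor_approx n (3 * x - 2) / 2 + 1/2"
      using 3 by simp_all
    ultimately show ?thesis
      unfolding power_Suc by linarith
  qed
qed

lemma continuous_cantor_approx: "continuous_on UNIV (cantor_approx n)"
proof (induction n)
  case 0
  have "cantor_approx 0 = (\<lambda>x. x)" by auto
  then show ?case by simp
next
  case (Suc n)
  have comp: "continuous_on S (\<lambda>x. cantor_approx n (l x))" if "continuous_on S l" for S and l :: "real \<Rightarrow> real"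
    using continuous_on_compose2[OF Suc that] by simp
  have "continuous_on UNIV (\<lambda>x. if x \<le> 1/3 then cantor_approx n (3 * x) / 2
      else if x \<le> 2/3 then 1/2
      else cantor_approx n (3 * x - 2) / 2 + 1/2)"
  proof (intro continuous_on_cases_le comp continuous_intros)
    fix x :: real
    show "1 / 2 = cantor_approx n (3 * x - 2) / 2 + 1 / 2" if "x = 2 / 3"
      by (simp add: that cantor_approx_0)
    show "cantor_approx n (3 * x) / 2 = (if x \<le> 2 / 3 then 1 / 2 else cantor_approx n (3 * x - 2) / 2 + 1 / 2)"
      if "x = 1 / 3"
      by (simp add: that cantor_approx_1)
  qed auto
  moreover have "cantor_approx (Suc n) = (\<lambda>x. if x \<le> 1/3 then cantor_approx n (3 * x) / 2
      else if x \<le> 2/3 then 1/2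
      else cantor_approx n (3 * x - 2) / 2 + 1/2)" by auto
  ultimately show ?case by simp
qed

text \<open>
  The approximations are the partial sums of the telescoping series of their differences, to which
  the Weierstrass M-test applies.
\<close>

lemma cantor_approx_uniform: "uniform_limit {0..1} cantor_approx cantor_function sequentially"
proof -
  define d where "d = (\<lambda>k x. cantor_approx (Suc k) x - cantor_approx k x)"
  have "uniform_limit {0..1} (\<lambda>n x. \<Sum>k<n. d k x) (\<lambda>x. \<Sum>k. d k x) sequentially"
  proof (rule Weierstrass_m_test)
    show "norm (d k x) \<le> (1/2) ^ k" if "x \<in> {0..1}" for k x
      using cantor_approx_step[OF that] by (simp add: d_def)
    show "summable (\<lambda>k. (1/2 :: real) ^ k)"
      by (rule summable_geometric) simp
  qed
  then have "uniform_limit {0..1} (\<lambda>n x. (\<Sum>k<n. d k x) + x) (\<lambda>x. (\<Sum>k. d k x) + x) sequentially"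
    by (intro uniform_limit_add uniform_limit_const)
  moreover have "(\<lambda>n x. (\<Sum>k<n. d k x) + x) = cantor_approx"
  proof (intro ext)
    fix n x
    show "(\<Sum>k<n. d k x) + x = cantor_approx n x"
      using sum_lessThan_telescope[of "\<lambda>k. cantor_approx k x" n] by (simp add: d_def)
  qed
  ultimately have lim: "uniform_limit {0..1} cantor_approx (\<lambda>x. (\<Sum>k. d k x) + x) sequentially"
    by simp
  have "cantor_function x = (\<Sum>k. d k x) + x" if "x \<in> {0..1}" for x
    unfolding cantor_function_def using tendsto_uniform_limitI[OF lim that] by (rule limI)
  then show ?thesis
    using lim by (subst uniform_limit_cong'[where g=cantor_approx and i="\<lambda>x. (\<Sum>k. d k x) + x"]) auto
qed

lemma cantor_approx_tendsto:
  "x \<in> {0..1} \<Longrightarrow> (\<lambda>n. cantor_approx n x) \<longlonglongrightarrow> cantor_function x"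
  using cantor_approx_uniform by (rule tendsto_uniform_limitI)

lemma continuous_cantor_function: "continuous_on {0..1} cantor_function"
  using uniform_limit_theorem[OF _ cantor_approx_uniform] continuous_cantor_approx
  by (meson always_eventually continuous_on_subset subset_UNIV sequentially_bot)

lemma cantor_function_0: "cantor_function 0 = 0" and cantor_function_1: "cantor_function 1 = 1"
  by (simp_all add: cantor_function_def cantor_approx_0 cantor_approx_1)

lemma cantor_function_left:
  assumes "x \<in> {0..1}"
  shows "cantor_function (x / 3) = cantor_function x / 2"
proof -
  have "(\<lambda>n. cantor_approx (Suc n) (x / 3)) \<longlonglongrightarrow> cantor_function (x / 3)"
    using assms by (intro LIMSEQ_Suc cantor_approx_tendsto) auto
  moreover have "cantor_approx (Suc n) (x / 3) = cantor_approx n x / 2" for n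
    using assms by simp
  moreover have "(\<lambda>n. cantor_approx n x / 2) \<longlonglongrightarrow> cantor_function x / 2"
    by (intro tendsto_intros cantor_approx_tendsto assms) simp
  ultimately show ?thesis
    using LIMSEQ_unique by (metis (no_types, lifting) ext)
qed

lemma cantor_function_right:
  assumes "x \<in> {0..1}"
  shows "cantor_function (x / 3 + 2 / 3) = cantor_function x / 2 + 1 / 2"
proof -
  have "(\<lambda>n. cantor_approx (Suc n) (x / 3 + 2 / 3)) \<longlonglongrightarrow> cantor_function (x / 3 + 2 / 3)"
    using assms by (intro LIMSEQ_Suc cantor_approx_tendsto) auto
  (* At x = 0 the argument is 2/3, where the recursion uses the middle branch. *)
  moreover have "cantor_approx (Suc n) (x / 3 + 2 / 3) = cantor_approx n x / 2 + 1 / 2" for n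
  proof (cases "x = 0")
    case True
    then show ?thesis by (simp add: cantor_approx_0)
  next
    case False
    then show ?thesis using assms by (simp add: algebra_simps)
  qed
  moreover have "(\<lambda>n. cantor_approx n x / 2 + 1 / 2) \<longlonglongrightarrow> cantor_function x / 2 + 1 / 2"
    by (intro tendsto_intros cantor_approx_tendsto assms) simp
  ultimately show ?thesis
    using LIMSEQ_unique by (metis (no_types, lifting) ext)
qed

section \<open>The Cantor dust\<close>

lemma contraction_unit_square: "p \<in> unit_square \<Longrightarrow> contraction k p \<in> unit_square"
  by (auto simp: contraction_def offset_def)

lemma word_map_Nil [simp]: "word_map [] p = p"
  by (simp add: word_map_def)

lemma word_map_Cons [simp]: "word_map (k # s) p = contraction k (word_map s p)"
  by (simp add: word_map_def)

lemma word_map_unit_square: "p \<in> unit_square \<Longrightarrow> word_map s p \<in> unit_square"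
  by (induction s) (auto intro: contraction_unit_square)

lemma corner_unit_square: "corner i \<in> unit_square"
  by (auto simp: corner_def)

lemma invariant_word_preimage:
  assumes K: "K = (\<Union>k\<in>{1, 2, 3, 4}. contraction k ` K)" and "p \<in> K"
  shows "\<exists>s\<in>words n. \<exists>q\<in>K. p = word_map s q"
  using \<open>p \<in> K\<close>
proof (induction n arbitrary: p)
  case 0
  then show ?case by (auto simp: words_def)
next
  case (Suc n)
  have "p \<in> (\<Union>k\<in>{1, 2, 3, 4}. contraction k ` K)"
    using Suc.prems by (subst K[symmetric])
  then obtain k q where k: "k \<in> {1, 2, 3, 4}" "q \<in> K" "p = contraction k q"
    by blast
  from Suc.IH[OF \<open>q \<in> K\<close>] obtain s r where s: "s \<in> words n" "r \<in> K" "q = word_map s r"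
    by blast
  have "k # s \<in> words (Suc n)" "p = word_map (k # s) r"
    using k s by (auto simp: words_def)
  then show ?case using \<open>r \<in> K\<close> by blast
qed

lemma invariant_word_image:
  assumes K: "K = (\<Union>k\<in>{1, 2, 3, 4}. contraction k ` K)" and "p \<in> K" "set s \<subseteq> {1, 2, 3, 4}"
  shows "word_map s p \<in> K"
  using assms(3)
proof (induction s)
  case Nil
  then show ?case using \<open>p \<in> K\<close> by simp
next
  case (Cons k s)
  then have "contraction k (word_map s p) \<in> (\<Union>k\<in>{1, 2, 3, 4}. contraction k ` K)"
    by auto
  then show ?case by (subst K) simp
qed

text \<open>
  A point of \<open>K\<close> lies for every \<open>n\<close> in the image of \<open>K\<close> under a word of length \<open>n\<close>. The same word moves any
  given point of \<open>L\<close> to a point of \<open>L\<close> at a distance of order \<open>3^-n\<close>, so the point is a limit of points of \<open>L\<close>.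
  Used in both directions, this is the uniqueness of the compact invariant set.
\<close>

lemma invariant_subset:
  assumes K: "K = (\<Union>k\<in>{1, 2, 3, 4}. contraction k ` K)"
    and L: "L = (\<Union>k\<in>{1, 2, 3, 4}. contraction k ` L)"
    and "bounded K" "closed L" "L \<noteq> {}"
  shows "K \<subseteq> L"
proof
  fix p assume "p \<in> K"
  obtain z where "z \<in> L" using \<open>L \<noteq> {}\<close> by blast
  obtain B where B: "\<And>q. q \<in> K \<Longrightarrow> dist z q \<le> B"
    using \<open>bounded K\<close> by (meson bounded_any_center)
  obtain w where w: "\<And>n. w n \<in> words n" "\<And>n. \<exists>q\<in>K. p = word_map (w n) q"
    using invariant_word_preimage[OF K \<open>p \<in> K\<close>] by metis
  have "word_map (w n) z \<in> L" for n
    using w(1)[of n] by (intro invariant_word_image[OF L \<open>z \<in> L\<close>]) (auto simp: words_def)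
  moreover have "(\<lambda>n. word_map (w n) z) \<longlonglongrightarrow> p"
  proof (rule metric_tendsto_imp_tendsto)
    show "(\<lambda>n. (1/3) ^ n * B) \<longlonglongrightarrow> 0"
      by (rule tendsto_mult_left_zero) (rule LIMSEQ_realpow_zero, auto)
    show "\<forall>\<^sub>F n in sequentially. dist (word_map (w n) z) p \<le> dist ((1/3) ^ n * B) 0"
    proof (intro always_eventually allI)
      fix n
      obtain q where q: "q \<in> K" "p = word_map (w n) q" using w(2) by blast
      have len: "length (w n) = n" using w(1)[of n] by (simp add: words_def)
      have "dist (word_map (w n) z) p = (1/3) ^ n * dist z q"
        unfolding q(2) word_map_affine[of "w n" z] word_map_affine[of "w n" q] len dist_norm
        by (simp add: scaleR_diff_right[symmetric] del: scaleR_diff_right)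
      also have "\<dots> \<le> (1/3) ^ n * B"
        by (intro mult_left_mono B q) auto
      finally show "dist (word_map (w n) z) p \<le> dist ((1/3) ^ n * B) 0"
        by simp
    qed
  qed
  ultimately show "p \<in> L"
    by (rule closed_sequentially[OF \<open>closed L\<close>])
qed

text \<open>
  The vertices of all squares of all generations. Their closure serves as a witness for the existence of the
  compact invariant set; with this choice the vertices lie in the dust by construction.
\<close>

definition vertex_set :: "(real \<times> real) set" where
  "vertex_set = {vertex s i |s i. set s \<subseteq> {1, 2, 3, 4}}"

lemma corner_fixed: "\<exists>k\<in>{1, 2, 3, 4}. contraction k (corner i) = corner i"
proof -
  define k :: nat where "k = (if i = 0 then 1 else if i = 1 then 3 else if i = 2 then 4 else 2)"
  have "contraction k (corner i) = corner i"
    by (auto simp: k_def contraction_def corner_def offset_def)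
  moreover have "k \<in> {1, 2, 3, 4}" by (simp add: k_def)
  ultimately show ?thesis by blast
qed

lemma corner_in_vertex_set: "corner i \<in> vertex_set"
proof -
  have "corner i = vertex [] i" by (simp add: vertex_def)
  then show ?thesis unfolding vertex_set_def by fastforce
qed

text \<open>
  Each corner of the unit square is the fixed point of one of the four contractions, so that the
  vertices of the empty word are also vertices of words of length one.
\<close>

lemma vertex_set_invariant: "vertex_set = (\<Union>k\<in>{1, 2, 3, 4}. contraction k ` vertex_set)"
proof (intro equalityI subsetI)
  fix p assume "p \<in> vertex_set"
  then obtain s i where s: "p = vertex s i" "set s \<subseteq> {1, 2, 3, 4}"
    by (auto simp: vertex_set_def)
  show "p \<in> (\<Union>k\<in>{1, 2, 3, 4}. contraction k ` vertex_set)"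
  proof (cases s)
    case Nil
    obtain k where k: "k \<in> {1, 2, 3, 4}" "contraction k (corner i) = corner i"
      using corner_fixed by blast
    have "p = contraction k (corner i)"
      using k s Nil by (simp add: vertex_def)
    then show ?thesis using k(1) corner_in_vertex_set by blast
  next
    case (Cons k t)
    then have "vertex t i \<in> vertex_set" "k \<in> {1, 2, 3, 4}" "p = contraction k (vertex t i)"
      using s by (auto simp: vertex_set_def vertex_def)
    then show ?thesis by blast
  qed
next
  fix p assume "p \<in> (\<Union>k\<in>{1, 2, 3, 4}. contraction k ` vertex_set)"
  then obtain k s i where k: "k \<in> {1, 2, 3, 4}" "set s \<subseteq> {1, 2, 3, 4}" "p = contraction k (vertex s i)"
    unfolding vertex_set_def by blast
  then have "p = vertex (k # s) i" "set (k # s) \<subseteq> {1, 2, 3, 4}"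
    by (auto simp: vertex_def)
  then show "p \<in> vertex_set" unfolding vertex_set_def by blast
qed

lemma closure_contraction: "closure (contraction k ` A) = contraction k ` closure A"
proof -
  have eq: "contraction k ` B = (+) ((1/3) *\<^sub>R offset k) ` (*\<^sub>R) (1/3) ` B" for B
    by (auto simp: contraction_def image_image add.commute)
  show ?thesis
    unfolding eq closure_translation closure_scaleR ..
qed

lemma vertex_set_unit_square: "vertex_set \<subseteq> unit_square"
  unfolding vertex_set_def vertex_def by (blast intro: word_map_unit_square corner_unit_square)

lemma cantor_dust_eq: "cantor_dust = closure vertex_set"
proof -
  let ?P = "\<lambda>K. compact K \<and> K \<noteq> {} \<and> K \<subseteq> unit_square \<and>
      K = (\<Union>s\<in>{1, 2, 3, 4}. contraction s ` K)"
  have sub: "closure vertex_set \<subseteq> unit_square"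
    by (intro closure_minimal vertex_set_unit_square closed_Times) auto
  have inv: "closure vertex_set = (\<Union>s\<in>{1, 2, 3, 4}. contraction s ` closure vertex_set)"
  proof -
    have "closure vertex_set = closure (\<Union>s\<in>{1, 2, 3, 4}. contraction s ` vertex_set)"
      by (rule arg_cong[OF vertex_set_invariant])
    also have "\<dots> = (\<Union>s\<in>{1, 2, 3, 4}. closure (contraction s ` vertex_set))"
      by simp
    finally show ?thesis by (simp only: closure_contraction)
  qed
  have ne: "closure vertex_set \<noteq> {}"
    using corner_in_vertex_set closure_subset by blast
  have bdd: "bounded (closure vertex_set)"
    by (rule bounded_subset[OF _ sub]) (intro compact_imp_bounded compact_Times compact_Icc)
  have "?P (closure vertex_set)"
    using bdd by (intro conjI inv ne sub) (simp add: compact_eq_bounded_closed)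
  moreover have "K = closure vertex_set" if "?P K" for K
  proof (rule equalityI)
    show "K \<subseteq> closure vertex_set"
      by (rule invariant_subset[of K]) (use that inv ne in \<open>blast intro: compact_imp_bounded closed_closure\<close>)+
    show "closure vertex_set \<subseteq> K"
      by (rule invariant_subset[of "closure vertex_set"]) (use that inv bdd in \<open>blast intro: compact_imp_closed\<close>)+
  qed
  ultimately show ?thesis
    unfolding cantor_dust_def by (rule the_equality)
qed

lemma vertex_in_cantor_dust: "s \<in> words n \<Longrightarrow> vertex s i \<in> cantor_dust"
  unfolding cantor_dust_eq by (rule subsetD[OF closure_subset]) (auto simp: vertex_set_def words_def)

lemma cantor_dust_subset: "cantor_dust \<subseteq> unit_square"
  unfolding cantor_dust_eq by (intro closure_minimal vertex_set_unit_square closed_Times) auto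

section \<open>The trace on a square\<close>

text \<open>
  The trace on a square in terms of the values at its vertices \<open>0, 1, 2, 3\<close>, grouped by the vertex at which
  \<open>f\<close> is evaluated. Each of the four inner terms is a discrete version of \<open>g_x h_y - g_y h_x\<close>.
\<close>

definition square_form :: "(nat \<Rightarrow> complex) \<Rightarrow> (nat \<Rightarrow> complex) \<Rightarrow> (nat \<Rightarrow> complex) \<Rightarrow> complex" where
  "square_form f g h =
     (f 0 * ((g 1 - g 0) * (h 2 - h 1) - (g 3 - g 0) * (h 2 - h 3)) +
      f 1 * ((g 1 - g 0) * (h 3 - h 0) - (g 2 - g 1) * (h 2 - h 3)) +
      f 2 * ((g 2 - g 3) * (h 3 - h 0) - (g 2 - g 1) * (h 1 - h 0)) +
      f 3 * ((g 2 - g 3) * (h 2 - h 1) - (g 3 - g 0) * (h 1 - h 0))) / 2"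

lemma trace_eq_square_form:
  "trace (mult_op s f ** commutator F_op (mult_op s g) ** commutator F_op (mult_op s h) ** M_op) =
    square_form (\<lambda>i. f (vertex s i)) (\<lambda>i. g (vertex s i)) (\<lambda>i. h (vertex s i))"
proof -
  (* The irrational factor of F_op occurs twice and contributes the factor 1/2. *)
  define F where "F = (vector
     [vector [0,  0,  1, 1],
      vector [0,  0, -1, 1],
      vector [1, -1,  0, 0],
      vector [1,  1,  0, 0]] :: complex^4^4)"
  have mult_right: "A ** (c *\<^sub>R B) = c *\<^sub>R (A ** B)" and mult_left: "(c *\<^sub>R A) ** B = c *\<^sub>R (A ** B)"
    for c and A B :: "complex^4^4"
    by (simp_all add: vec_eq_iff matrix_matrix_mult_def scaleR_sum_right)
  have trace_scaleR: "trace (c *\<^sub>R A) = c *\<^sub>R trace A" for c and A :: "complex^4^4"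
    by (simp add: trace_def scaleR_sum_right)
  have F_op: "F_op = (1 / sqrt 2) *\<^sub>R F"
    by (simp add: F_op_def F_def)
  have comm: "commutator F_op A = (1 / sqrt 2) *\<^sub>R commutator F A" for A
    by (simp add: F_op commutator_def mult_right mult_left scaleR_diff_right)
  have "trace (mult_op s f ** commutator F_op (mult_op s g) ** commutator F_op (mult_op s h) ** M_op) =
     (1/2) *\<^sub>R trace (mult_op s f ** commutator F (mult_op s g) ** commutator F (mult_op s h) ** M_op)"
    by (simp add: comm mult_right mult_left trace_scaleR)
  also have "\<dots> = square_form (\<lambda>i. f (vertex s i)) (\<lambda>i. g (vertex s i)) (\<lambda>i. h (vertex s i))"
    by (simp add: trace_def sum_4 matrix_matrix_mult_def commutator_def F_def mult_op_def M_op_def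
        vector_4 square_form_def scaleR_conv_of_real field_simps)
  finally show ?thesis .
qed

text \<open>
  For \<open>f = 1\<close> the form is twice the shoelace expression for the oriented area of the quadrilateral with vertices
  \<open>(g i, h i)\<close>, hence a sum over the four oriented edges.
\<close>

lemma square_form_one:
  "square_form (\<lambda>i. 1) g h = (g 0 * h 1 - g 1 * h 0) + (g 1 * h 2 - g 2 * h 1)
     + (g 2 * h 3 - g 3 * h 2) + (g 3 * h 0 - g 0 * h 3)"
  by (simp add: square_form_def field_simps)

lemma phi_n_eq_sum_square_form: "phi_n n f g h = (\<Sum>s\<in>words n.
    square_form (\<lambda>i. f (vertex s i)) (\<lambda>i. g (vertex s i)) (\<lambda>i. h (vertex s i)))"
  by (simp add: phi_n_def trace_eq_square_form)

section \<open>From words to the dyadic grid\<close>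

definition cantor_pair :: "real \<times> real \<Rightarrow> real \<times> real" where
  "cantor_pair p = (cantor_function (fst p), cantor_function (snd p))"

lemma cantor_map_eq: "cantor_map p = abs_torus (cantor_pair p)"
  by (simp add: cantor_map_def cantor_pair_def)

lemma cantor_pair_corner: "cantor_pair (corner i) = corner i"
  by (simp add: cantor_pair_def corner_def cantor_function_0 cantor_function_1)

lemma cantor_pair_contraction:
  assumes "p \<in> unit_square"
  shows "cantor_pair (contraction k p) = (1/2) *\<^sub>R cantor_pair p + (1/4) *\<^sub>R offset k"
proof -
  obtain x y where p: "p = (x, y)" by fastforce
  with assms have xy: "x \<in> {0..1}" "y \<in> {0..1}" by auto
  show ?thesis
    using xy[THEN cantor_function_left] xy[THEN cantor_function_right]
    by (simp add: p cantor_pair_def contraction_def offset_def)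
qed

text \<open>
  The lower left vertex of the dyadic square that the Cantor functions assign to a word. An offset
  coordinate is \<open>0\<close> or \<open>2\<close> and stands for the binary digit \<open>0\<close> or \<open>1\<close>, whence the factor \<open>1/4\<close>.
\<close>

primrec dyadic_corner :: "nat list \<Rightarrow> real \<times> real" where
  "dyadic_corner [] = 0"
| "dyadic_corner (k # s) = (1/2) *\<^sub>R dyadic_corner s + (1/4) *\<^sub>R offset k"

lemma cantor_pair_vertex:
  "cantor_pair (vertex s i) = dyadic_corner s + (1/2) ^ length s *\<^sub>R corner i"
proof (induction s)
  case Nil
  then show ?case by (simp add: vertex_def cantor_pair_corner)
next
  case (Cons k s)
  have "vertex s i \<in> unit_square"
    unfolding vertex_def by (intro word_map_unit_square corner_unit_square)
  from cantor_pair_contraction[OF this, of k] Cons.IH show ?case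
    by (simp add: vertex_def scaleR_add_right)
qed

lemma sum_lessThan_double:
  "(\<Sum>i<2 * N. (\<psi> :: nat \<Rightarrow> 'a::comm_monoid_add) i) = (\<Sum>i<N. \<psi> i) + (\<Sum>i<N. \<psi> (N + i))"
  using sum.atLeastLessThan_concat[of 0 N "2 * N" \<psi>] sum.shift_bounds_nat_ivl[of \<psi> 0 N N]
  by (simp add: lessThan_atLeast0 mult_2 add.commute)

text \<open>
  The lower left vertices of the words of length \<open>n\<close> run through the dyadic grid once each: prepending a letter
  chooses one of the four quadrants, which splits the ranges of both indices into halves.
\<close>

lemma sum_words_dyadic_corner:
  fixes \<psi> :: "real \<times> real \<Rightarrow> 'a::comm_monoid_add"
  shows "(\<Sum>s\<in>words n. \<psi> (dyadic_corner s)) =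
    (\<Sum>i<2^n. \<Sum>j<2^n. \<psi> (real i / 2^n, real j / 2^n))"
proof (induction n arbitrary: \<psi>)
  case 0
  have "words 0 = {[]}" by (auto simp: words_def)
  then show ?case by (simp add: zero_prod_def)
next
  case (Suc n)
  have words_Suc: "words (Suc n) = (\<lambda>(k, s). k # s) ` ({1, 2, 3, 4} \<times> words n)"
    by (auto simp: words_def length_Suc_conv image_iff)
  have "(\<Sum>s\<in>words (Suc n). \<psi> (dyadic_corner s)) =
      (\<Sum>k\<in>{1, 2, 3, 4}. \<Sum>s\<in>words n. \<psi> (dyadic_corner (k # s)))"
    unfolding words_Suc by (subst sum.reindex) (auto simp: inj_on_def sum.cartesian_product split_def)
  also have "\<dots> = (\<Sum>k\<in>{1, 2, 3, 4}. \<Sum>i<2^n. \<Sum>j<2^n.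
      \<psi> ((1/2) *\<^sub>R (real i / 2^n, real j / 2^n) + (1/4) *\<^sub>R offset k))"
    unfolding dyadic_corner.simps
    by (intro sum.cong refl Suc.IH[of "\<lambda>p. \<psi> ((1/2) *\<^sub>R p + (1/4) *\<^sub>R offset _)"])
  also have "\<dots> = (\<Sum>i<2^Suc n. \<Sum>j<2^Suc n. \<psi> (real i / 2^Suc n, real j / 2^Suc n))"
    by (simp add: sum_lessThan_double sum.distrib offset_def add_divide_distrib ac_simps)
  finally show ?case .
qed

definition grid_sum :: "nat \<Rightarrow> (real \<times> real \<Rightarrow> complex) \<Rightarrow> (real \<times> real \<Rightarrow> complex) \<Rightarrow> (real \<times> real \<Rightarrow> complex) \<Rightarrow> complex" where
  "grid_sum n f g h = (\<Sum>i<2^n. \<Sum>j<2^n. square_form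
     (\<lambda>k. f ((real i / 2^n, real j / 2^n) + (1/2)^n *\<^sub>R corner k))
     (\<lambda>k. g ((real i / 2^n, real j / 2^n) + (1/2)^n *\<^sub>R corner k))
     (\<lambda>k. h ((real i / 2^n, real j / 2^n) + (1/2)^n *\<^sub>R corner k)))"

lemma phi_n_pullback:
  "phi_n n (pullback f) (pullback g) (pullback h) =
    grid_sum n (f \<circ> abs_torus) (g \<circ> abs_torus) (h \<circ> abs_torus)"
proof -
  have val: "pullback u (vertex s i) = (u \<circ> abs_torus) (dyadic_corner s + (1/2)^n *\<^sub>R corner i)"
    if "s \<in> words n" for u s i
    using that vertex_in_cantor_dust[OF that, of i]
    by (simp add: pullback_def cantor_map_eq cantor_pair_vertex words_def)
  show ?thesis
    unfolding phi_n_eq_sum_square_form grid_sum_def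
    by (subst sum_words_dyadic_corner[symmetric]) (simp add: val)
qed

text \<open>
  Discrete Stokes theorem on the torus: the boundary terms of neighbouring squares cancel on
  common edges, and periodicity identifies the opposite sides of the unit square.
\<close>

lemma grid_sum_one_periodic:
  assumes g: "\<And>p. g (p + (1, 0)) = g p" "\<And>p. g (p + (0, 1)) = g p"
    and h: "\<And>p. h (p + (1, 0)) = h p" "\<And>p. h (p + (0, 1)) = h p"
  shows "grid_sum n (\<lambda>_. 1) g h = 0"
proof -
  define P where "P = (\<lambda>i j. (real i / 2^n, real j / 2^n))"
  (* Contributions of the horizontal and vertical edges, oriented to the right and upwards. *)
  define hor where "hor = (\<lambda>i j. g (P i j) * h (P (Suc i) j) - g (P (Suc i) j) * h (P i j))"
  define ver where "ver = (\<lambda>i j. g (P i j) * h (P i (Suc j)) - g (P i (Suc j)) * h (P i j))"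
  have corners: "P i j + (1/2)^n *\<^sub>R corner 0 = P i j" "P i j + (1/2)^n *\<^sub>R corner 1 = P (Suc i) j"
    "P i j + (1/2)^n *\<^sub>R corner 2 = P (Suc i) (Suc j)" "P i j + (1/2)^n *\<^sub>R corner 3 = P i (Suc j)" for i j
    by (simp_all add: P_def corner_def field_simps)
  have cell: "square_form (\<lambda>k. 1) (\<lambda>k. g (P i j + (1/2)^n *\<^sub>R corner k)) (\<lambda>k. h (P i j + (1/2)^n *\<^sub>R corner k))
     = (hor i j - hor i (Suc j)) + (ver (Suc i) j - ver i j)" for i j
    unfolding square_form_one corners by (simp add: hor_def ver_def algebra_simps)
  have per: "P i (2^n) = P i 0 + (0, 1)" "P (2^n) j = P 0 j + (1, 0)" for i j
    by (simp_all add: P_def)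
  have "hor i (2^n) = hor i 0" for i
    by (simp add: hor_def per g h)
  then have hor: "(\<Sum>j<2^n. hor i j - hor i (Suc j)) = 0" for i
    by (subst sum_lessThan_telescope') simp
  have "ver (2^n) j = ver 0 j" for j
    by (simp add: ver_def per g h)
  then have ver: "(\<Sum>i<2^n. ver (Suc i) j - ver i j) = 0" for j
    by (subst sum_lessThan_telescope) simp
  have "grid_sum n (\<lambda>_. 1) g h = (\<Sum>i<2^n. \<Sum>j<2^n. (hor i j - hor i (Suc j)) + (ver (Suc i) j - ver i j))"
    unfolding grid_sum_def by (intro sum.cong refl cell[unfolded P_def])
  also have "\<dots> = (\<Sum>i<2^n. \<Sum>j<2^n. hor i j - hor i (Suc j)) + (\<Sum>j<2^n. \<Sum>i<2^n. ver (Suc i) j - ver i j)"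
    unfolding sum.distrib by (subst (2) sum.swap) simp
  finally show ?thesis by (simp only: hor ver sum.neutral_const add_0)
qed

section \<open>Difference quotients\<close>

text \<open>
  Mean value inequality along a segment, for the map with the linear term subtracted. With \<open>w = 0\<close> it is a
  Lipschitz bound; with \<open>w\<close> the derivative at a nearby point it shows convergence of difference
  quotients whose base point moves.
\<close>

lemma difference_bound:
  fixes G :: "'a::real_normed_vector \<Rightarrow> 'b::real_normed_vector"
  assumes diff: "\<And>p. G differentiable (at p)"
    and B: "\<And>t. t \<in> {0..1} \<Longrightarrow> norm (frechet_derivative G (at (q + (t * e) *\<^sub>R v)) v - w) \<le> B"
    and e: "0 \<le> e"
  shows "norm (G (q + e *\<^sub>R v) - G q - e *\<^sub>R w) \<le> e * B"
proof -
  define \<phi> where "\<phi> = (\<lambda>t. G (q + (t * e) *\<^sub>R v) - (t * e) *\<^sub>R w)"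
  define d where "d = (\<lambda>t. frechet_derivative G (at (q + (t * e) *\<^sub>R v)) v - w)"
  have "norm (\<phi> 1 - \<phi> 0) \<le> (e * B) * norm (1 - 0 :: real)"
  proof (rule differentiable_bound)
    fix t :: real assume t: "t \<in> {0..1}"
    have lin: "linear (frechet_derivative G (at (q + (t * e) *\<^sub>R v)))"
      using diff by (rule linear_frechet_derivative)
    have "(\<phi> has_derivative (\<lambda>s. frechet_derivative G (at (q + (t * e) *\<^sub>R v)) ((s * e) *\<^sub>R v) - (s * e) *\<^sub>R w))
        (at t within {0..1})"
      unfolding \<phi>_def
      by (rule derivative_eq_intros has_derivative_compose[where g = G and f = "\<lambda>t. q + (t * e) *\<^sub>R v"]
          diff[unfolded frechet_derivative_works] refl | simp)+
    also have "(\<lambda>s. frechet_derivative G (at (q + (t * e) *\<^sub>R v)) ((s * e) *\<^sub>R v) - (s * e) *\<^sub>R w) =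
        (\<lambda>s. (s * e) *\<^sub>R d t)"
      using linear_scale[OF lin] by (auto simp: d_def scaleR_diff_right)
    finally show "(\<phi> has_derivative (\<lambda>s. (s * e) *\<^sub>R d t)) (at t within {0..1})" .
    show "onorm (\<lambda>s. (s * e) *\<^sub>R d t) \<le> e * B"
    proof (rule onorm_le)
      fix s :: real
      show "norm ((s * e) *\<^sub>R d t) \<le> e * B * norm s"
        using mult_left_mono[OF B[OF t, folded d_def], of "\<bar>s\<bar> * e"] e
        by (simp add: d_def abs_mult mult_ac)
    qed
  qed auto
  then show ?thesis by (simp add: \<phi>_def algebra_simps)
qed

lemma Ck_1D:
  assumes "Ck 1 u"
  shows "u differentiable (at p)" and "continuous_on UNIV (\<lambda>p. frechet_derivative u (at p) v)"
  using assms unfolding One_nat_def Ck.simps by blast+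

lemma difference_quotient_tendsto:
  fixes G :: "'a::real_normed_vector \<Rightarrow> 'b::real_normed_vector"
  assumes G: "Ck 1 G" and q: "q \<longlonglongrightarrow> p" and e: "e \<longlonglongrightarrow> 0" "\<And>n. 0 < e n"
  shows "(\<lambda>n. (1 / e n) *\<^sub>R (G (q n + e n *\<^sub>R v) - G (q n))) \<longlonglongrightarrow> frechet_derivative G (at p) v"
proof (rule tendstoI)
  fix \<epsilon> :: real assume "0 < \<epsilon>"
  have diff: "\<And>p. G differentiable (at p)" and cont: "continuous_on UNIV (\<lambda>p. frechet_derivative G (at p) v)"
    using Ck_1D[OF G] by blast+
  obtain \<delta> where \<delta>: "0 < \<delta>"
    "\<And>x. dist x p < \<delta> \<Longrightarrow> dist (frechet_derivative G (at x) v) (frechet_derivative G (at p) v) < \<epsilon> / 2"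
    using cont \<open>0 < \<epsilon>\<close> unfolding continuous_on_iff by (metis UNIV_I half_gt_zero)
  have "(\<lambda>n. dist (q n) p + e n * norm v) \<longlonglongrightarrow> dist p p + 0 * norm v"
    by (intro tendsto_intros q e)
  then have "\<forall>\<^sub>F n in sequentially. dist (q n) p + e n * norm v < \<delta>"
    using \<delta>(1) by (intro order_tendstoD) auto
  then show "\<forall>\<^sub>F n in sequentially.
      dist ((1 / e n) *\<^sub>R (G (q n + e n *\<^sub>R v) - G (q n))) (frechet_derivative G (at p) v) < \<epsilon>"
  proof (rule eventually_mono)
    fix n assume n: "dist (q n) p + e n * norm v < \<delta>"
    let ?w = "frechet_derivative G (at p) v"
    have "norm (G (q n + e n *\<^sub>R v) - G (q n) - e n *\<^sub>R ?w) \<le> e n * (\<epsilon> / 2)"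
    proof (rule difference_bound[OF diff])
      fix t :: real assume t: "t \<in> {0..1}"
      have "dist (q n + (t * e n) *\<^sub>R v) p \<le> dist (q n) p + norm ((t * e n) *\<^sub>R v)"
        unfolding dist_norm by (metis add_diff_eq add.commute norm_triangle_ineq)
      also have "norm ((t * e n) *\<^sub>R v) \<le> e n * norm v"
        using t e(2)[of n] mult_right_mono[of t 1 "e n * norm v"] by (simp add: abs_mult)
      finally show "norm (frechet_derivative G (at (q n + (t * e n) *\<^sub>R v)) v - ?w) \<le> \<epsilon> / 2"
        using \<delta>(2)[of "q n + (t * e n) *\<^sub>R v"] n by (simp add: dist_norm)
    qed (simp add: e(2) less_imp_le)
    then have "(1 / e n) * norm (G (q n + e n *\<^sub>R v) - G (q n) - e n *\<^sub>R ?w) \<le> \<epsilon> / 2"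
      using e(2)[of n] by (simp add: pos_divide_le_eq mult.commute)
    moreover have "(1 / e n) *\<^sub>R (G (q n + e n *\<^sub>R v) - G (q n)) - ?w
        = (1 / e n) *\<^sub>R (G (q n + e n *\<^sub>R v) - G (q n) - e n *\<^sub>R ?w)"
      using e(2)[of n] by (simp add: scaleR_diff_right)
    ultimately have "dist ((1 / e n) *\<^sub>R (G (q n + e n *\<^sub>R v) - G (q n))) ?w \<le> \<epsilon> / 2"
      using e(2)[of n] by (simp only: dist_norm norm_scaleR) simp
    then show "dist ((1 / e n) *\<^sub>R (G (q n + e n *\<^sub>R v) - G (q n))) ?w < \<epsilon>"
      using \<open>0 < \<epsilon>\<close> by simp
  qed
qed

text \<open>
  The form is bilinear in the differences along the edges, so the square of the scaling factor can
  be distributed over them.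
\<close>

lemma square_form_tendsto:
  fixes f g h :: "nat \<Rightarrow> nat \<Rightarrow> complex" and c :: "nat \<Rightarrow> complex"
  assumes f: "\<And>k. (\<lambda>n. f n k) \<longlonglongrightarrow> a"
    and g: "(\<lambda>n. c n * (g n 1 - g n 0)) \<longlonglongrightarrow> gx" "(\<lambda>n. c n * (g n 2 - g n 3)) \<longlonglongrightarrow> gx"
      "(\<lambda>n. c n * (g n 3 - g n 0)) \<longlonglongrightarrow> gy" "(\<lambda>n. c n * (g n 2 - g n 1)) \<longlonglongrightarrow> gy"
    and h: "(\<lambda>n. c n * (h n 1 - h n 0)) \<longlonglongrightarrow> hx" "(\<lambda>n. c n * (h n 2 - h n 3)) \<longlonglongrightarrow> hx"
      "(\<lambda>n. c n * (h n 3 - h n 0)) \<longlonglongrightarrow> hy" "(\<lambda>n. c n * (h n 2 - h n 1)) \<longlonglongrightarrow> hy"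
  shows "(\<lambda>n. (c n)\<^sup>2 * square_form (f n) (g n) (h n)) \<longlonglongrightarrow> 2 * (a * (gx * hy - gy * hx))"
proof -
  let ?d = "\<lambda>u n i j. c n * (u n i - u n j)"
  have "(\<lambda>n. (f n 0 * (?d g n 1 0 * ?d h n 2 1 - ?d g n 3 0 * ?d h n 2 3) +
      f n 1 * (?d g n 1 0 * ?d h n 3 0 - ?d g n 2 1 * ?d h n 2 3) +
      f n 2 * (?d g n 2 3 * ?d h n 3 0 - ?d g n 2 1 * ?d h n 1 0) +
      f n 3 * (?d g n 2 3 * ?d h n 2 1 - ?d g n 3 0 * ?d h n 1 0)) / 2) \<longlonglongrightarrow>
     (a * (gx * hy - gy * hx) + a * (gx * hy - gy * hx) + a * (gx * hy - gy * hx) + a * (gx * hy - gy * hx)) / 2"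
    by (intro tendsto_intros f g h) simp
  moreover have "(c n)\<^sup>2 * square_form (f n) (g n) (h n) =
      (f n 0 * (?d g n 1 0 * ?d h n 2 1 - ?d g n 3 0 * ?d h n 2 3) +
      f n 1 * (?d g n 1 0 * ?d h n 3 0 - ?d g n 2 1 * ?d h n 2 3) +
      f n 2 * (?d g n 2 3 * ?d h n 3 0 - ?d g n 2 1 * ?d h n 1 0) +
      f n 3 * (?d g n 2 3 * ?d h n 2 1 - ?d g n 3 0 * ?d h n 1 0)) / 2" for n
    unfolding square_form_def power2_eq_square by algebra
  moreover have "(a * (gx * hy - gy * hx) + a * (gx * hy - gy * hx) + a * (gx * hy - gy * hx) + a * (gx * hy - gy * hx)) / 2
      = 2 * (a * (gx * hy - gy * hx))" by simp
  ultimately show ?thesis by (simp only:)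
qed

lemma norm_square_form_le:
  assumes f: "\<And>k. norm (f k) \<le> A"
    and g: "norm (g 1 - g 0) \<le> B" "norm (g 2 - g 3) \<le> B" "norm (g 3 - g 0) \<le> B" "norm (g 2 - g 1) \<le> B"
    and h: "norm (h 1 - h 0) \<le> B" "norm (h 2 - h 3) \<le> B" "norm (h 3 - h 0) \<le> B" "norm (h 2 - h 1) \<le> B"
  shows "norm (square_form f g h) \<le> 4 * A * B\<^sup>2"
proof -
  have product: "norm (f k * (a * b - c * d)) \<le> A * (2 * B\<^sup>2)"
    if "norm a \<le> B" "norm b \<le> B" "norm c \<le> B" "norm d \<le> B" for k and a b c d :: complex
  proof -
    have "0 \<le> B" using that(1) norm_ge_zero order_trans by blast
    have "norm (a * b - c * d) \<le> norm a * norm b + norm c * norm d"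
      by (metis norm_triangle_ineq4 norm_mult)
    also have "\<dots> \<le> B * B + B * B"
      using that \<open>0 \<le> B\<close> by (intro add_mono mult_mono) auto
    finally show ?thesis
      unfolding norm_mult using f[of k] by (intro mult_mono) (auto simp: power2_eq_square intro: order_trans[OF norm_ge_zero])
  qed
  have sum4: "norm ((a + b + c + d) / 2) \<le> 2 * K" if "norm a \<le> K" "norm b \<le> K" "norm c \<le> K" "norm d \<le> K"
    for a b c d :: complex and K
    using that norm_triangle_ineq[of "a + b + c" d] norm_triangle_ineq[of "a + b" c] norm_triangle_ineq[of a b]
    by (simp add: norm_divide)
  have "norm (square_form f g h) \<le> 2 * (A * (2 * B\<^sup>2))"
    unfolding square_form_def by (intro sum4 product g h)
  then show ?thesis by simp
qed

section \<open>Dyadic cells\<close>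

text \<open>
  Half-open squares are pairwise disjoint, so that the step functions below are sums of indicators.
\<close>

definition cell :: "nat \<Rightarrow> nat \<Rightarrow> nat \<Rightarrow> (real \<times> real) set" where
  "cell n i j = {real i / 2^n ..< (real i + 1) / 2^n} \<times> {real j / 2^n ..< (real j + 1) / 2^n}"

lemma measure_cell: "measure lborel (cell n i j) = (1/4)^n"
  and emeasure_cell_finite: "emeasure lborel (cell n i j) < \<infinity>"
  and sets_cell: "cell n i j \<in> sets lborel"
proof -
  have "emeasure lborel (cell n i j) = emeasure (lborel \<Otimes>\<^sub>M lborel) (cell n i j)"
    by (simp add: lborel_prod)
  also have "\<dots> = ennreal (1/2^n) * ennreal (1/2^n)"
    unfolding cell_def by (subst lborel.emeasure_pair_measure_Times) (auto simp: divide_right_mono diff_divide_distrib[symmetric])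
  also have "\<dots> = ennreal ((1/4)^n)"
    by (simp add: ennreal_mult[symmetric] power_divide power_mult_distrib[symmetric])
  finally have *: "emeasure lborel (cell n i j) = ennreal ((1/4)^n)" .
  then show "emeasure lborel (cell n i j) < \<infinity>" by simp
  show "measure lborel (cell n i j) = (1/4)^n"
    using * by (simp add: measure_def)
  show "cell n i j \<in> sets lborel"
    unfolding cell_def sets_lborel by (intro borel_Times) auto
qed

lemma mem_cell_iff:
  assumes "0 \<le> x" "0 \<le> y"
  shows "(x, y) \<in> cell n i j \<longleftrightarrow> i = nat \<lfloor>2^n * x\<rfloor> \<and> j = nat \<lfloor>2^n * y\<rfloor>"
proof -
  have "real k / 2^n \<le> z \<and> z < (real k + 1) / 2^n \<longleftrightarrow> k = nat \<lfloor>2^n * z\<rfloor>" if "0 \<le> z" for z k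
  proof -
    have "real k / 2^n \<le> z \<and> z < (real k + 1) / 2^n \<longleftrightarrow> real k \<le> 2^n * z \<and> 2^n * z < real k + 1"
      by (simp add: field_simps)
    also have "\<dots> \<longleftrightarrow> \<lfloor>2^n * z\<rfloor> = int k"
      by (simp add: floor_eq_iff)
    also have "\<dots> \<longleftrightarrow> k = nat \<lfloor>2^n * z\<rfloor>"
      using that by (auto simp: nat_eq_iff2)
    finally show ?thesis .
  qed
  then show ?thesis using assms by (auto simp: cell_def)
qed

definition half_open_square :: "(real \<times> real) set" where
  "half_open_square = {0..<1} \<times> {0..<1}"

lemma cell_subset:
  assumes "i < 2^n" "j < 2^n"
  shows "cell n i j \<subseteq> half_open_square"
proof -
  have bound: "(real k + 1) / 2^n \<le> 1" if "k < 2^n" for k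
  proof -
    have "real (Suc k) \<le> real (2^n)" using that by (subst of_nat_le_iff) simp
    then show ?thesis by (simp add: add.commute)
  qed
  have "{real k / 2^n ..< (real k + 1) / 2^n} \<subseteq> {0..<1}" if "k < 2^n" for k
  proof
    fix x assume "x \<in> {real k / 2^n ..< (real k + 1) / 2^n}"
    moreover have "0 \<le> real k / 2^n" by simp
    ultimately show "x \<in> {0..<1}"
      using bound[OF that] unfolding atLeastLessThan_iff by linarith
  qed
  then show ?thesis
    unfolding cell_def half_open_square_def using assms by (intro Sigma_mono) auto
qed

text \<open>
  The lower left vertex of the dyadic cell that contains the point.
\<close>

definition lattice_point :: "nat \<Rightarrow> real \<times> real \<Rightarrow> real \<times> real" where
  "lattice_point n p = (real (nat \<lfloor>2^n * fst p\<rfloor>) / 2^n, real (nat \<lfloor>2^n * snd p\<rfloor>) / 2^n)"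

lemma nat_floor_less:
  fixes z :: real
  assumes "0 \<le> z" "z < 1"
  shows "nat \<lfloor>2^n * z\<rfloor> < 2^n"
proof -
  have "2^n * z < 2^n" using assms by simp
  then show ?thesis using assms by (simp add: nat_less_iff floor_less_iff)
qed

lemma sum_cells:
  fixes \<psi> :: "real \<times> real \<Rightarrow> 'a::real_vector"
  assumes "p \<in> half_open_square"
  shows "(\<Sum>i<2^n. \<Sum>j<2^n. indicator (cell n i j) p *\<^sub>R \<psi> (real i / 2^n, real j / 2^n)) = \<psi> (lattice_point n p)"
proof -
  obtain x y where p: "p = (x, y)" by fastforce
  have xy: "0 \<le> x" "x < 1" "0 \<le> y" "y < 1"
    using assms by (auto simp: p half_open_square_def)
  define I where "I = nat \<lfloor>2^n * x\<rfloor>"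
  define J where "J = nat \<lfloor>2^n * y\<rfloor>"
  have IJ: "I < 2^n" "J < 2^n" using nat_floor_less xy by (auto simp: I_def J_def)
  have "indicator (cell n i j) p *\<^sub>R \<psi> (real i / 2^n, real j / 2^n) =
      (if i = I then if j = J then \<psi> (real I / 2^n, real J / 2^n) else 0 else 0)" for i j
    using xy by (auto simp: p indicator_def mem_cell_iff I_def J_def)
  then have "(\<Sum>j<2^n. indicator (cell n i j) p *\<^sub>R \<psi> (real i / 2^n, real j / 2^n)) =
      (if i = I then \<psi> (real I / 2^n, real J / 2^n) else 0)" for i
    using IJ by (cases "i = I") simp_all
  then have "(\<Sum>i<2^n. \<Sum>j<2^n. indicator (cell n i j) p *\<^sub>R \<psi> (real i / 2^n, real j / 2^n)) =
      (\<Sum>i<2^n. if i = I then \<psi> (real I / 2^n, real J / 2^n) else 0)"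
    by simp
  also have "\<dots> = \<psi> (real I / 2^n, real J / 2^n)"
    using IJ by simp
  finally show ?thesis by (simp add: lattice_point_def p I_def J_def)
qed

lemma lattice_point_tendsto:
  assumes "p \<in> half_open_square"
  shows "(\<lambda>n. lattice_point n p) \<longlonglongrightarrow> p"
proof -
  have "(\<lambda>n. real (nat \<lfloor>2^n * z\<rfloor>) / 2^n) \<longlonglongrightarrow> z" if "0 \<le> z" for z :: real
  proof (rule tendsto_sandwich)
    show "(\<lambda>n. z - (1/2)^n) \<longlonglongrightarrow> z" using LIMSEQ_realpow_zero[of "1/2"]
      by (auto intro!: tendsto_eq_intros)
    show "\<forall>\<^sub>F n in sequentially. z - (1/2)^n \<le> real (nat \<lfloor>2^n * z\<rfloor>) / 2^n"
    proof (intro always_eventually allI)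
      fix n
      have "2^n * z - 1 \<le> real (nat \<lfloor>2^n * z\<rfloor>)" using that by linarith
      then have "(2^n * z - 1) / 2^n \<le> real (nat \<lfloor>2^n * z\<rfloor>) / 2^n" by (rule divide_right_mono) simp
      then show "z - (1/2)^n \<le> real (nat \<lfloor>2^n * z\<rfloor>) / 2^n" by (simp add: diff_divide_distrib power_divide)
    qed
    show "\<forall>\<^sub>F n in sequentially. real (nat \<lfloor>2^n * z\<rfloor>) / 2^n \<le> z"
    proof (intro always_eventually allI)
      fix n
      have "real (nat \<lfloor>2^n * z\<rfloor>) \<le> 2^n * z" using that by simp
      then show "real (nat \<lfloor>2^n * z\<rfloor>) / 2^n \<le> z" by (simp add: field_simps)
    qed
  qed simp
  then show ?thesis
    using assms unfolding lattice_point_def half_open_square_def by (auto intro!: tendsto_Pair)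
qed

lemma AE_unit_square_half_open: "AE p in lborel. p \<in> unit_square \<longrightarrow> p \<in> half_open_square"
proof -
  have "emeasure lborel ({1 :: real} \<times> (UNIV :: real set)) = emeasure (lborel \<Otimes>\<^sub>M lborel) ({1 :: real} \<times> (UNIV :: real set))"
    by (simp add: lborel_prod)
  also have "\<dots> = 0" by (subst lborel.emeasure_pair_measure_Times) auto
  finally have 1: "{1} \<times> UNIV \<in> null_sets (lborel :: (real \<times> real) measure)"
    by (auto intro!: null_setsI borel_Times)
  have "emeasure lborel ((UNIV :: real set) \<times> {1 :: real}) = emeasure (lborel \<Otimes>\<^sub>M lborel) ((UNIV :: real set) \<times> {1 :: real})"
    by (simp add: lborel_prod)
  also have "\<dots> = 0" by (subst lborel.emeasure_pair_measure_Times) auto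
  finally have 2: "UNIV \<times> {1} \<in> null_sets (lborel :: (real \<times> real) measure)"
    by (auto intro!: null_setsI borel_Times)
  show ?thesis
    using AE_not_in[OF 1] AE_not_in[OF 2] by eventually_elim (auto simp: half_open_square_def less_le)
qed

lemma lattice_point_cell:
  assumes "p \<in> half_open_square"
  shows "0 \<le> fst (lattice_point n p)" "fst (lattice_point n p) + (1/2)^n \<le> 1"
    "0 \<le> snd (lattice_point n p)" "snd (lattice_point n p) + (1/2)^n \<le> 1"
proof -
  have "real (nat \<lfloor>2^n * z\<rfloor>) / 2^n + (1/2)^n \<le> 1" if "0 \<le> z" "z < 1" for z :: real
  proof -
    have "real (Suc (nat \<lfloor>2^n * z\<rfloor>)) \<le> real (2^n)"
      unfolding of_nat_le_iff using nat_floor_less[OF that] by (rule Suc_leI)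
    then have "(real (nat \<lfloor>2^n * z\<rfloor>) + 1) / 2^n \<le> 1" by (simp add: add.commute)
    then show ?thesis by (simp add: add_divide_distrib power_divide)
  qed
  then show "0 \<le> fst (lattice_point n p)" "fst (lattice_point n p) + (1/2)^n \<le> 1"
    "0 \<le> snd (lattice_point n p)" "snd (lattice_point n p) + (1/2)^n \<le> 1"
    using assms by (auto simp: lattice_point_def half_open_square_def)
qed

section \<open>Convergence of the grid sums to the integral\<close>

text \<open>
  The grid sum is the integral of a step function, whose value on a cell is the form divided by the
  area of the cell. Its pointwise limit comes from the convergence of difference quotients, its uniform bound from
  the Lipschitz estimates on the edges of the cell, and dominated convergence exchanges limit and integral.
\<close>

theorem grid_sum_tendsto:
  assumes f: "continuous_on UNIV f" and g: "Ck 1 g" and h: "Ck 1 h"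
  shows "(\<lambda>n. grid_sum n f g h) \<longlonglongrightarrow> 2 * (LINT p:unit_square|lborel.
    f p * wedge (frechet_derivative g (at p)) (frechet_derivative h (at p)) (1, 0) (0, 1))"
proof -
  define J where "J = (\<lambda>p. f p * wedge (frechet_derivative g (at p)) (frechet_derivative h (at p)) (1, 0) (0, 1))"
  define val where "val = (\<lambda>n q. (2^n)\<^sup>2 * square_form (\<lambda>k. f (q + (1/2)^n *\<^sub>R corner k))
     (\<lambda>k. g (q + (1/2)^n *\<^sub>R corner k)) (\<lambda>k. h (q + (1/2)^n *\<^sub>R corner k)))"
  define step where "step = (\<lambda>n p. \<Sum>i<2^n. \<Sum>j<2^n. indicator (cell n i j) p *\<^sub>R val n (real i / 2^n, real j / 2^n))"
  define lim where "lim = (\<lambda>p. indicator unit_square p *\<^sub>R (2 * J p))"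
  have J_cont: "continuous_on UNIV J"
    unfolding J_def wedge_def by (intro continuous_intros f Ck_1D(2)[OF g] Ck_1D(2)[OF h])
  have step_val: "step n p = val n (lattice_point n p)" if "p \<in> half_open_square" for n p
    unfolding step_def using that by (rule sum_cells)
  have step_0: "step n p = 0" if "p \<notin> half_open_square" for n p
  proof -
    have "p \<notin> cell n i j" if "i < 2^n" "j < 2^n" for i j
      using \<open>p \<notin> half_open_square\<close> cell_subset[OF that] by blast
    then show ?thesis unfolding step_def by (intro sum.neutral ballI) simp
  qed
  have grid: "integral\<^sup>L lborel (step n) = grid_sum n f g h" for n
  proof -
    have "has_bochner_integral lborel (\<lambda>p. indicator (cell n i j) p *\<^sub>R c) ((1/4)^n *\<^sub>R c)" for i j and c :: complex
      unfolding measure_cell[of n i j, symmetric]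
      by (intro has_bochner_integral_scaleR_left has_bochner_integral_real_indicator sets_cell emeasure_cell_finite)
    then have "has_bochner_integral lborel (step n) (\<Sum>i<2^n. \<Sum>j<2^n. (1/4)^n *\<^sub>R val n (real i / 2^n, real j / 2^n))"
      unfolding step_def by (intro has_bochner_integral_sum)
    then have "integral\<^sup>L lborel (step n) = (\<Sum>i<2^n. \<Sum>j<2^n. (1/4)^n *\<^sub>R val n (real i / 2^n, real j / 2^n))"
      by (rule has_bochner_integral_integral_eq)
    also have "\<dots> = grid_sum n f g h"
      by (simp add: val_def grid_sum_def scaleR_conv_of_real power_divide power2_eq_square power_mult_distrib[symmetric])
    finally show ?thesis .
  qed
  (* Differences along the edges, written as increments in the coordinate directions. *)
  have differences: "g (q + r *\<^sub>R corner 1) - g (q + r *\<^sub>R corner 0) = g (q + r *\<^sub>R (1, 0)) - g q"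
    "g (q + r *\<^sub>R corner 2) - g (q + r *\<^sub>R corner 3) = g ((q + r *\<^sub>R (0, 1)) + r *\<^sub>R (1, 0)) - g (q + r *\<^sub>R (0, 1))"
    "g (q + r *\<^sub>R corner 3) - g (q + r *\<^sub>R corner 0) = g (q + r *\<^sub>R (0, 1)) - g q"
    "g (q + r *\<^sub>R corner 2) - g (q + r *\<^sub>R corner 1) = g ((q + r *\<^sub>R (1, 0)) + r *\<^sub>R (0, 1)) - g (q + r *\<^sub>R (1, 0))"
    for g :: "real \<times> real \<Rightarrow> complex" and q r
    by (cases q; simp add: corner_def)+
  have step_lim: "(\<lambda>n. step n p) \<longlonglongrightarrow> 2 * J p" if p: "p \<in> half_open_square" for p
  proof -
    define q where "q = (\<lambda>n. lattice_point n p)"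
    have q: "q \<longlonglongrightarrow> p" unfolding q_def using p by (rule lattice_point_tendsto)
    have r: "(\<lambda>n. (1/2 :: real)^n) \<longlonglongrightarrow> 0" by (rule LIMSEQ_realpow_zero) auto
    have shift: "(\<lambda>n. q n + (1/2)^n *\<^sub>R v) \<longlonglongrightarrow> p" for v
      using tendsto_add[OF q tendsto_scaleR[OF r tendsto_const[of v]]] by simp
    have quot: "(\<lambda>n. 2^n * (u (x n + (1/2)^n *\<^sub>R v) - u (x n))) \<longlonglongrightarrow> frechet_derivative u (at p) v"
      if "Ck 1 u" "x \<longlonglongrightarrow> p" for u :: "real \<times> real \<Rightarrow> complex" and x v
      using difference_quotient_tendsto[OF that r] by (simp add: power_divide scaleR_conv_of_real)
    have "(\<lambda>n. val n (q n)) \<longlonglongrightarrow> 2 * J p"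
      unfolding val_def J_def wedge_def
    proof (rule square_form_tendsto, goal_cases)
      case (1 k)
      have "isCont f p" using f by (auto simp only: continuous_on_eq_continuous_at open_UNIV)
      then show ?case by (rule isCont_tendsto_compose[OF _ shift])
    qed (unfold differences, (intro quot g h q shift)+)
    then show ?thesis by (simp add: step_val[OF p] q_def)
  qed
  have bounded_on: "\<exists>B. \<forall>p\<in>unit_square. norm (u p) \<le> B" if "continuous_on UNIV u" for u :: "real \<times> real \<Rightarrow> complex"
  proof -
    have "compact (u ` unit_square)"
      by (intro compact_continuous_image compact_Times compact_Icc continuous_on_subset[OF that]) simp
    then show ?thesis by (auto dest!: compact_imp_bounded simp: bounded_iff)
  qed
  obtain A where A: "\<And>p. p \<in> unit_square \<Longrightarrow> norm (f p) \<le> A"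
    using bounded_on[OF f] by blast
  have "\<exists>B. \<forall>v\<in>{(1, 0), (0, 1)}. \<forall>p\<in>unit_square. norm (frechet_derivative u (at p) v) \<le> B"
    if "Ck 1 u" for u :: "real \<times> real \<Rightarrow> complex"
  proof -
    have "\<exists>B. \<forall>p\<in>unit_square. norm (frechet_derivative u (at p) v) \<le> B" for v
      by (intro bounded_on Ck_1D(2)[OF that])
    then obtain B where "\<And>v p. p \<in> unit_square \<Longrightarrow> norm (frechet_derivative u (at p) v) \<le> B v"
      by metis
    then have "\<forall>v\<in>{(1, 0), (0, 1)}. \<forall>p\<in>unit_square. norm (frechet_derivative u (at p) v) \<le> max (B (1, 0)) (B (0, 1))"
      by (auto simp: le_max_iff_disj)
    then show ?thesis by blast
  qed
  from this[OF g] this[OF h] obtain Bg Bh where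
    Bg: "\<And>v p. v \<in> {(1, 0), (0, 1)} \<Longrightarrow> p \<in> unit_square \<Longrightarrow> norm (frechet_derivative g (at p) v) \<le> Bg"
    and Bh: "\<And>v p. v \<in> {(1, 0), (0, 1)} \<Longrightarrow> p \<in> unit_square \<Longrightarrow> norm (frechet_derivative h (at p) v) \<le> Bh"
    by meson
  define B where "B = max Bg Bh"
  have K: "norm (step n p) \<le> 4 * A * B\<^sup>2" if p: "p \<in> half_open_square" for n p
  proof -
    define q where "q = lattice_point n p"
    define r where "r = (1/2 :: real)^n"
    have r: "0 \<le> r" by (simp add: r_def)
    obtain x y where q_eq: "q = (x, y)" by fastforce
    have cell_in: "0 \<le> x" "x + r \<le> 1" "0 \<le> y" "y + r \<le> 1"
      using lattice_point_cell[OF p, of n] by (simp_all add: q_def[symmetric] q_eq r_def)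
    have inside: "q + s *\<^sub>R (1, 0) + t *\<^sub>R (0, 1) \<in> unit_square" if "s \<in> {0..r}" "t \<in> {0..r}" for s t
      using that cell_in by (auto simp: q_eq)
    (* The four edges of the cell, each given by its starting point and its direction. *)
    have edge: "norm (u (z + r *\<^sub>R v) - u z) \<le> r * B"
      if u: "u = g \<or> u = h" and z: "(z, v) \<in> {(q, (1, 0)), (q, (0, 1)), (q + r *\<^sub>R (0, 1), (1, 0)), (q + r *\<^sub>R (1, 0), (0, 1))}" for u z v
    proof -
      have "norm (u (z + r *\<^sub>R v) - u z - r *\<^sub>R 0) \<le> r * B"
      proof (rule difference_bound)
        show "u differentiable (at w)" for w using u g h Ck_1D(1) by blast
        fix t :: real assume "t \<in> {0..1}"
        then have "t * r \<in> {0..r}" using r by (simp add: mult_left_le_one_le)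
        moreover have "0 \<in> {0..r}" "r \<in> {0..r}" using r by auto
        ultimately have "z + (t * r) *\<^sub>R v \<in> unit_square"
          using z inside[of "t * r" 0] inside[of "t * r" r] inside[of 0 "t * r"] inside[of r "t * r"]
          by (auto simp: q_eq)
        then show "norm (frechet_derivative u (at (z + (t * r) *\<^sub>R v)) v - 0) \<le> B"
          using u z Bg[of v "z + (t * r) *\<^sub>R v"] Bh[of v "z + (t * r) *\<^sub>R v"] by (auto simp: B_def le_max_iff_disj)
      qed (rule r)
      then show ?thesis by simp
    qed
    have "norm (f (q + r *\<^sub>R corner k)) \<le> A" for k
      using cell_in r by (intro A) (auto simp: q_eq corner_def)
    then have "norm (square_form (\<lambda>k. f (q + r *\<^sub>R corner k))
        (\<lambda>k. g (q + r *\<^sub>R corner k)) (\<lambda>k. h (q + r *\<^sub>R corner k))) \<le> 4 * A * (r * B)\<^sup>2"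
      by (rule norm_square_form_le) (unfold differences, (rule edge, simp, simp)+)
    then have "(2^n)\<^sup>2 * norm (square_form (\<lambda>k. f (q + r *\<^sub>R corner k))
        (\<lambda>k. g (q + r *\<^sub>R corner k)) (\<lambda>k. h (q + r *\<^sub>R corner k))) \<le> (2^n)\<^sup>2 * (4 * A * (r * B)\<^sup>2)"
      by (rule mult_left_mono) simp
    also have "(2^n)\<^sup>2 * (4 * A * (r * B)\<^sup>2) = (2^n * r)\<^sup>2 * (4 * A * B\<^sup>2)"
      by (simp add: power_mult_distrib)
    also have "\<dots> = 4 * A * B\<^sup>2"
      by (simp add: r_def power_divide)
    finally show ?thesis
      by (simp add: step_val[OF p] val_def q_def[symmetric] r_def[symmetric] norm_mult norm_power)
  qed
  have "(\<lambda>n. integral\<^sup>L lborel (step n)) \<longlonglongrightarrow> integral\<^sup>L lborel lim"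
  proof (rule integral_dominated_convergence[where w = "\<lambda>p. indicator unit_square p *\<^sub>R (4 * A * B\<^sup>2)"])
    show "lim \<in> borel_measurable lborel"
      unfolding lim_def using J_cont
      by (intro borel_measurable_integrable borel_integrable_compact compact_Times compact_Icc)
        (auto intro!: continuous_intros elim: continuous_on_subset)
    show "step n \<in> borel_measurable lborel" for n
      unfolding step_def using sets_cell by measurable
    show "integrable lborel (\<lambda>p. indicator unit_square p *\<^sub>R (4 * A * B\<^sup>2))"
      by (intro borel_integrable_compact compact_Times compact_Icc continuous_intros)
    show "AE p in lborel. (\<lambda>n. step n p) \<longlonglongrightarrow> lim p"
      using AE_unit_square_half_open
    proof eventually_elim
      case (elim p)
      show ?case
      proof (cases "p \<in> unit_square")
        case True
        then show ?thesis using step_lim elim by (simp add: lim_def)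
      next
        case False
        then have "p \<notin> half_open_square" by (auto simp: half_open_square_def)
        then show ?thesis using False by (simp add: lim_def step_0)
      qed
    qed
    show "AE p in lborel. norm (step n p) \<le> indicator unit_square p *\<^sub>R (4 * A * B\<^sup>2)" for n
    proof (intro AE_I2)
      fix p
      show "norm (step n p) \<le> indicator unit_square p *\<^sub>R (4 * A * B\<^sup>2)"
      proof (cases "p \<in> half_open_square")
        case True
        then have "p \<in> unit_square" by (auto simp: half_open_square_def)
        then show ?thesis using K[OF True] by simp
      next
        case False
        have "0 \<le> 4 * A * B\<^sup>2"
          by (rule order_trans[OF norm_ge_zero K[of "(0, 0)" 0]]) (simp add: half_open_square_def)
        then show ?thesis by (simp add: step_0[OF False] indicator_def)
      qed
    qed
  qed
  moreover have "integral\<^sup>L lborel lim = 2 * (LINT p:unit_square|lborel. J p)"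
  proof -
    have "lim = (\<lambda>p. 2 * (indicator unit_square p *\<^sub>R J p))"
      unfolding lim_def mult_scaleR_right ..
    then show ?thesis
      unfolding set_lebesgue_integral_def by (simp only: integral_mult_right_zero)
  qed
  ultimately show ?thesis by (simp add: grid J_def)
qed

section \<open>The algebra of pullbacks of smooth functions\<close>

lemma Ck_Suc_imp_Ck: "Ck (Suc k) u \<Longrightarrow> Ck k u"
proof (induction k arbitrary: u)
  case 0
  then show ?case
    by (auto intro!: differentiable_imp_continuous_on simp: differentiable_on_def)
next
  case (Suc k)
  show ?case
    unfolding Ck.simps(2)[of k u]
  proof (intro conjI allI)
    show "u differentiable (at p)" for p using Suc.prems by simp
    show "Ck k (\<lambda>p. frechet_derivative u (at p) v)" for v
      using Suc.prems by (intro Suc.IH) (simp only: Ck.simps(2)[of "Suc k" u])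
  qed
qed

lemma Ck_const: "Ck k (\<lambda>_. c)"
  by (induction k arbitrary: c) (simp_all add: frechet_derivative_const)

lemma frechet_derivative_add:
  assumes "u differentiable (at p)" "w differentiable (at p)"
  shows "frechet_derivative (\<lambda>p. u p + w p) (at p) = (\<lambda>v. frechet_derivative u (at p) v + frechet_derivative w (at p) v)"
  using has_derivative_add[OF assms[unfolded frechet_derivative_works]]
  by (rule frechet_derivative_at[symmetric])

lemma frechet_derivative_mult:
  fixes u w :: "'a::real_normed_vector \<Rightarrow> 'b::real_normed_algebra"
  assumes "u differentiable (at p)" "w differentiable (at p)"
  shows "frechet_derivative (\<lambda>p. u p * w p) (at p) = (\<lambda>v. u p * frechet_derivative w (at p) v + frechet_derivative u (at p) v * w p)"
  using has_derivative_mult[OF assms[unfolded frechet_derivative_works]]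
  by (rule frechet_derivative_at[symmetric])

lemma Ck_add: "Ck k u \<Longrightarrow> Ck k w \<Longrightarrow> Ck k (\<lambda>p. u p + w p)"
  by (induction k arbitrary: u w) (auto simp: frechet_derivative_add intro: continuous_on_add)

lemma Ck_mult:
  fixes u w :: "'a::real_normed_vector \<Rightarrow> 'b::real_normed_algebra"
  shows "Ck k u \<Longrightarrow> Ck k w \<Longrightarrow> Ck k (\<lambda>p. u p * w p)"
proof (induction k arbitrary: u w)
  case 0
  then show ?case by (simp add: continuous_on_mult)
next
  case (Suc k)
  have k: "Ck k u" "Ck k w" using Suc.prems Ck_Suc_imp_Ck by auto
  show ?case
    using Suc.prems
    by (auto simp: frechet_derivative_mult intro!: Ck_add Suc.IH k)
qed

lemma smooth_torus_Ck: "f \<in> smooth_torus \<Longrightarrow> Ck k (f \<circ> abs_torus)"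
  by (simp add: smooth_torus_def)

lemma smooth_torus_const: "(\<lambda>_. c) \<in> smooth_torus"
  by (simp add: smooth_torus_def o_def Ck_const)

lemma smooth_torus_add: "f \<in> smooth_torus \<Longrightarrow> g \<in> smooth_torus \<Longrightarrow> (\<lambda>x. f x + g x) \<in> smooth_torus"
  by (simp add: smooth_torus_def o_def Ck_add)

lemma smooth_torus_mult: "f \<in> smooth_torus \<Longrightarrow> g \<in> smooth_torus \<Longrightarrow> (\<lambda>x. f x * g x) \<in> smooth_torus"
  by (simp add: smooth_torus_def o_def Ck_mult)

lemma fadd_pullback: "fadd cantor_dust (pullback f) (pullback g) = pullback (\<lambda>x. f x + g x)"
  and fmult_pullback: "fmult cantor_dust (pullback f) (pullback g) = pullback (\<lambda>x. f x * g x)"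
  and fscale_pullback: "fscale cantor_dust z (pullback f) = pullback (\<lambda>x. z * f x)"
  by (auto simp: fadd_def fmult_def fscale_def pullback_def restrict_def)

lemma continuous_cantor_pair: "continuous_on unit_square cantor_pair"
  unfolding cantor_pair_def
  by (intro continuous_on_Pair continuous_on_compose2[OF continuous_cantor_function]
      continuous_on_fst continuous_on_snd continuous_on_id) auto

lemma pullback_continuous:
  assumes "f \<in> smooth_torus"
  shows "pullback f \<in> continuous_functions cantor_dust"
proof -
  have "continuous_on UNIV (f \<circ> abs_torus)"
    using smooth_torus_Ck[OF assms, of 0] by simp
  then have "continuous_on cantor_dust (\<lambda>p. (f \<circ> abs_torus) (cantor_pair p))"
    using continuous_on_subset[OF continuous_cantor_pair cantor_dust_subset]
    by (rule continuous_on_compose2) auto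
  then have "continuous_on cantor_dust (pullback f)"
    by (rule continuous_on_eq) (simp add: pullback_def cantor_map_eq)
  then show ?thesis by (simp add: continuous_functions_def pullback_def)
qed

lemma subalgebra_pullback: "subalgebra_of_continuous cantor_dust pullback_algebra"
  unfolding subalgebra_of_continuous_def
proof (intro conjI allI ballI)
  show "pullback_algebra \<subseteq> continuous_functions cantor_dust"
    using pullback_continuous by (auto simp: pullback_algebra_def)
  have "(\<lambda>x\<in>cantor_dust. 1) = pullback (\<lambda>_. 1)"
    by (auto simp: pullback_def)
  then show "(\<lambda>x\<in>cantor_dust. 1) \<in> pullback_algebra"
    by (simp add: pullback_algebra_def smooth_torus_const)
  fix a b z assume "a \<in> pullback_algebra" "b \<in> pullback_algebra"
  then show "fadd cantor_dust a b \<in> pullback_algebra" "fmult cantor_dust a b \<in> pullback_algebra"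
    by (auto simp: pullback_algebra_def fadd_pullback fmult_pullback smooth_torus_add smooth_torus_mult)
next
  fix a z assume "a \<in> pullback_algebra"
  then show "fscale cantor_dust z a \<in> pullback_algebra"
    by (auto simp: pullback_algebra_def fscale_pullback smooth_torus_mult smooth_torus_const)
qed

section \<open>The limit functional\<close>

theorem phi_n_tendsto:
  assumes "f \<in> smooth_torus" "g \<in> smooth_torus" "h \<in> smooth_torus"
  shows "(\<lambda>n. phi_n n (pullback f) (pullback g) (pullback h)) \<longlonglongrightarrow> 2 * torus_integral f g h"
proof -
  have "continuous_on UNIV (f \<circ> abs_torus)"
    using smooth_torus_Ck[OF assms(1), of 0] by simp
  from grid_sum_tendsto[OF this smooth_torus_Ck[OF assms(2)] smooth_torus_Ck[OF assms(3)]] show ?thesis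
    by (simp add: phi_n_pullback torus_integral_def torus_d_def[abs_def])
qed

lemma phi_pullback:
  "f \<in> smooth_torus \<Longrightarrow> g \<in> smooth_torus \<Longrightarrow> h \<in> smooth_torus \<Longrightarrow>
    phi (pullback f) (pullback g) (pullback h) = 2 * torus_integral f g h"
  unfolding phi_def by (intro limI phi_n_tendsto)

lemma linear_functional_on_limit:
  assumes closed: "\<And>f g. f \<in> A \<Longrightarrow> g \<in> A \<Longrightarrow> fadd X f g \<in> A" "\<And>z f. f \<in> A \<Longrightarrow> fscale X z f \<in> A"
    and lin: "\<And>n. linear_functional_on X A (L n)"
    and conv: "\<And>f. f \<in> A \<Longrightarrow> convergent (\<lambda>n. L n f)"
  shows "linear_functional_on X A (\<lambda>f. lim (\<lambda>n. L n f))"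
proof -
  have lim: "(\<lambda>n. L n f) \<longlonglongrightarrow> lim (\<lambda>n. L n f)" if "f \<in> A" for f
    using conv[OF that] by (simp add: convergent_LIMSEQ_iff)
  show ?thesis
    unfolding linear_functional_on_def
  proof (intro conjI ballI allI)
    fix f g assume fg: "f \<in> A" "g \<in> A"
    have "L n (fadd X f g) = L n f + L n g" for n
      using lin[of n] fg by (simp add: linear_functional_on_def)
    then show "lim (\<lambda>n. L n (fadd X f g)) = lim (\<lambda>n. L n f) + lim (\<lambda>n. L n g)"
      using tendsto_add[OF lim[OF fg(1)] lim[OF fg(2)]] by (simp add: limI)
  next
    fix z f assume f: "f \<in> A"
    have "L n (fscale X z f) = z * L n f" for n
      using lin[of n] f by (simp add: linear_functional_on_def)
    then show "lim (\<lambda>n. L n (fscale X z f)) = z * lim (\<lambda>n. L n f)"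
      using tendsto_mult_left[OF lim[OF f], of z] by (simp add: limI)
  qed
qed

text \<open>
  The operations on functions on the dust are pointwise only on the dust, so this depends on the vertices being
  points of the dust.
\<close>

lemma trilinear_phi_n: "trilinear_on cantor_dust A (phi_n n)"
proof -
  have add: "fadd cantor_dust f g (vertex s i) = f (vertex s i) + g (vertex s i)"
    and scale: "fscale cantor_dust z f (vertex s i) = z * f (vertex s i)"
    if "s \<in> words n" for f g z s i
    using vertex_in_cantor_dust[OF that] by (simp_all add: fadd_def fscale_def)
  show ?thesis
    unfolding trilinear_on_def linear_functional_on_def phi_n_eq_sum_square_form
      sum.distrib[symmetric] sum_distrib_left
    by (intro conjI ballI allI sum.cong refl; simp add: add scale square_form_def field_simps)
qed

lemma trilinear_phi: "trilinear_on cantor_dust pullback_algebra phi"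
proof -
  have closed: "fadd cantor_dust f g \<in> pullback_algebra" "fscale cantor_dust z f \<in> pullback_algebra"
    if "f \<in> pullback_algebra" "g \<in> pullback_algebra" for f g z
    using subalgebra_pullback that by (auto simp: subalgebra_of_continuous_def)
  have conv: "convergent (\<lambda>n. phi_n n f g h)"
    if "f \<in> pullback_algebra" "g \<in> pullback_algebra" "h \<in> pullback_algebra" for f g h
    using that phi_n_tendsto by (auto simp: pullback_algebra_def intro: convergentI)
  have "linear_functional_on cantor_dust pullback_algebra (\<lambda>f. phi_n n f a b) \<and>
        linear_functional_on cantor_dust pullback_algebra (\<lambda>f. phi_n n a f b) \<and>
        linear_functional_on cantor_dust pullback_algebra (\<lambda>f. phi_n n a b f)"
    if "a \<in> pullback_algebra" "b \<in> pullback_algebra" for n a b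
    using trilinear_phi_n[of pullback_algebra n] that unfolding trilinear_on_def by blast
  then show ?thesis
    unfolding trilinear_on_def phi_def
    by (intro ballI conjI linear_functional_on_limit closed conv) auto
qed

section \<open>The cocycle identities\<close>

lemma torus_d_mult:
  assumes "f \<in> smooth_torus" "g \<in> smooth_torus"
  shows "torus_d (\<lambda>x. f x * g x) p v = f (abs_torus p) * torus_d g p v + torus_d f p v * g (abs_torus p)"
  using frechet_derivative_mult[of "f \<circ> abs_torus" p "g \<circ> abs_torus"]
    Ck_1D(1)[OF smooth_torus_Ck[OF assms(1)]] Ck_1D(1)[OF smooth_torus_Ck[OF assms(2)]]
  by (simp add: torus_d_def o_def)

lemma torus_integrand_integrable:
  assumes "f \<in> smooth_torus" "g \<in> smooth_torus" "h \<in> smooth_torus"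
  shows "set_integrable lborel unit_square (\<lambda>p. f (abs_torus p) * wedge (torus_d g p) (torus_d h p) (1, 0) (0, 1))"
proof -
  have "continuous_on UNIV (\<lambda>p. f (abs_torus p))"
    using smooth_torus_Ck[OF assms(1), of 0] by (simp add: o_def)
  moreover have "continuous_on UNIV (\<lambda>p. torus_d g p v)" "continuous_on UNIV (\<lambda>p. torus_d h p v)" for v
    unfolding torus_d_def by (intro Ck_1D(2) smooth_torus_Ck assms)+
  ultimately have "continuous_on UNIV (\<lambda>p. f (abs_torus p) * wedge (torus_d g p) (torus_d h p) (1, 0) (0, 1))"
    unfolding wedge_def by (intro continuous_intros)
  then show ?thesis
    unfolding set_integrable_def
    by (intro borel_integrable_compact compact_Times compact_Icc) (rule continuous_on_subset, auto)
qed

text \<open>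
  The integral is the limit of a sequence of combinatorial integrals each of which vanishes by the
  discrete Stokes theorem.
\<close>

lemma torus_integral_exact:
  assumes "g \<in> smooth_torus" "h \<in> smooth_torus"
  shows "torus_integral (\<lambda>_. 1) g h = 0"
proof -
  have per: "(u \<circ> abs_torus) (p + (1, 0)) = (u \<circ> abs_torus) p" "(u \<circ> abs_torus) (p + (0, 1)) = (u \<circ> abs_torus) p"
    for u :: "torus \<Rightarrow> complex" and p
  proof -
    have "abs_torus (p + (1, 0)) = abs_torus p" "abs_torus (p + (0, 1)) = abs_torus p"
      unfolding torus.abs_eq_iff torus_rel_def by simp_all
    then show "(u \<circ> abs_torus) (p + (1, 0)) = (u \<circ> abs_torus) p" "(u \<circ> abs_torus) (p + (0, 1)) = (u \<circ> abs_torus) p"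
      by simp_all
  qed
  have "phi_n n (pullback (\<lambda>_. 1)) (pullback g) (pullback h) = 0" for n
  proof -
    have "(\<lambda>_. 1 :: complex) \<circ> abs_torus = (\<lambda>_. 1)" by auto
    then show ?thesis unfolding phi_n_pullback by (simp only:) (intro grid_sum_one_periodic per)
  qed
  then have "(\<lambda>n. 0) \<longlonglongrightarrow> 2 * torus_integral (\<lambda>_. 1) g h"
    using phi_n_tendsto[OF smooth_torus_const[of 1] assms] by simp
  then show ?thesis by (simp add: LIMSEQ_const_iff)
qed

text \<open>
  By the Leibniz rule \<open>f dg \<and> dh - g dh \<and> df = d(f g) \<and> dh\<close>, and the integral of the latter vanishes.
\<close>

lemma torus_integral_cyclic:
  assumes "f \<in> smooth_torus" "g \<in> smooth_torus" "h \<in> smooth_torus"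
  shows "torus_integral g h f = torus_integral f g h"
proof -
  let ?I = "\<lambda>f g h p. f (abs_torus p) * wedge (torus_d g p) (torus_d h p) (1, 0) (0, 1)"
  have "torus_integral f g h - torus_integral g h f = (LINT p:unit_square|lborel. ?I f g h p - ?I g h f p)"
    unfolding torus_integral_def by (simp only: set_integral_diff torus_integrand_integrable assms)
  also have "(\<lambda>p. ?I f g h p - ?I g h f p) = ?I (\<lambda>_. 1) (\<lambda>x. f x * g x) h"
    by (simp add: torus_d_mult assms wedge_def algebra_simps)
  also have "(LINT p:unit_square|lborel. ?I (\<lambda>_. 1) (\<lambda>x. f x * g x) h p) = torus_integral (\<lambda>_. 1) (\<lambda>x. f x * g x) h"
    by (simp only: torus_integral_def)
  also have "\<dots> = 0" by (intro torus_integral_exact smooth_torus_mult assms)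
  finally show ?thesis by simp
qed

text \<open>
  The integrands cancel pointwise, because \<open>torus_d\<close> is a derivation.
\<close>

lemma torus_integral_hochschild:
  assumes f: "f0 \<in> smooth_torus" "f1 \<in> smooth_torus" "f2 \<in> smooth_torus" "f3 \<in> smooth_torus"
  shows "torus_integral (\<lambda>x. f0 x * f1 x) f2 f3 - torus_integral f0 (\<lambda>x. f1 x * f2 x) f3
    + torus_integral f0 f1 (\<lambda>x. f2 x * f3 x) - torus_integral (\<lambda>x. f3 x * f0 x) f1 f2 = 0"
proof -
  let ?I = "\<lambda>f g h p. f (abs_torus p) * wedge (torus_d g p) (torus_d h p) (1, 0) (0, 1)"
  have int: "set_integrable lborel unit_square (?I (\<lambda>x. f0 x * f1 x) f2 f3)"
    "set_integrable lborel unit_square (?I f0 (\<lambda>x. f1 x * f2 x) f3)"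
    "set_integrable lborel unit_square (?I f0 f1 (\<lambda>x. f2 x * f3 x))"
    "set_integrable lborel unit_square (?I (\<lambda>x. f3 x * f0 x) f1 f2)"
    by (intro torus_integrand_integrable smooth_torus_mult f)+
  have "torus_integral (\<lambda>x. f0 x * f1 x) f2 f3 - torus_integral f0 (\<lambda>x. f1 x * f2 x) f3
    + torus_integral f0 f1 (\<lambda>x. f2 x * f3 x) - torus_integral (\<lambda>x. f3 x * f0 x) f1 f2 =
    (LINT p:unit_square|lborel. ?I (\<lambda>x. f0 x * f1 x) f2 f3 p - ?I f0 (\<lambda>x. f1 x * f2 x) f3 p
      + ?I f0 f1 (\<lambda>x. f2 x * f3 x) p - ?I (\<lambda>x. f3 x * f0 x) f1 f2 p)"
    unfolding torus_integral_def
    by (simp only: set_integral_diff set_integral_add int)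
  also have "(\<lambda>p. ?I (\<lambda>x. f0 x * f1 x) f2 f3 p - ?I f0 (\<lambda>x. f1 x * f2 x) f3 p
      + ?I f0 f1 (\<lambda>x. f2 x * f3 x) p - ?I (\<lambda>x. f3 x * f0 x) f1 f2 p) = (\<lambda>p. 0)"
    by (simp add: torus_d_mult f wedge_def algebra_simps)
  finally show ?thesis by simp
qed

lemma cyclic_2_cocycle_phi: "cyclic_2_cocycle_on cantor_dust pullback_algebra phi"
  unfolding cyclic_2_cocycle_on_def
proof (intro conjI ballI trilinear_phi)
  fix a0 a1 a2 assume "a0 \<in> pullback_algebra" "a1 \<in> pullback_algebra" "a2 \<in> pullback_algebra"
  then show "phi a1 a2 a0 = phi a0 a1 a2"
    by (auto simp: pullback_algebra_def phi_pullback torus_integral_cyclic)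
next
  fix a0 a1 a2 a3
  assume "a0 \<in> pullback_algebra" "a1 \<in> pullback_algebra" "a2 \<in> pullback_algebra" "a3 \<in> pullback_algebra"
  then obtain f0 f1 f2 f3 where f: "f0 \<in> smooth_torus" "f1 \<in> smooth_torus" "f2 \<in> smooth_torus" "f3 \<in> smooth_torus"
    and a: "a0 = pullback f0" "a1 = pullback f1" "a2 = pullback f2" "a3 = pullback f3"
    by (auto simp: pullback_algebra_def)
  have "phi (fmult cantor_dust a0 a1) a2 a3 - phi a0 (fmult cantor_dust a1 a2) a3
      + phi a0 a1 (fmult cantor_dust a2 a3) - phi (fmult cantor_dust a3 a0) a1 a2 =
      2 * (torus_integral (\<lambda>x. f0 x * f1 x) f2 f3 - torus_integral f0 (\<lambda>x. f1 x * f2 x) f3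
      + torus_integral f0 f1 (\<lambda>x. f2 x * f3 x) - torus_integral (\<lambda>x. f3 x * f0 x) f1 f2)"
    by (simp add: a fmult_pullback phi_pullback smooth_torus_mult f algebra_simps)
  then show "phi (fmult cantor_dust a0 a1) a2 a3 - phi a0 (fmult cantor_dust a1 a2) a3
      + phi a0 a1 (fmult cantor_dust a2 a3) - phi (fmult cantor_dust a3 a0) a1 a2 = 0"
    unfolding torus_integral_hochschild[OF f] by simp
qed

theorem theorem1:
  shows "(\<forall>f\<in>smooth_torus. \<forall>g\<in>smooth_torus. \<forall>h\<in>smooth_torus.
            (\<lambda>n. phi_n n (pullback f) (pullback g) (pullback h)) \<longlonglongrightarrow> 2 * torus_integral f g h) \<and>
         (\<forall>f\<in>smooth_torus. \<forall>g\<in>smooth_torus. \<forall>h\<in>smooth_torus.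
          \<forall>f'\<in>smooth_torus. \<forall>g'\<in>smooth_torus. \<forall>h'\<in>smooth_torus.
            pullback f = pullback f' \<and> pullback g = pullback g' \<and> pullback h = pullback h' \<longrightarrow>
            2 * torus_integral f g h = 2 * torus_integral f' g' h') \<and>
         subalgebra_of_continuous cantor_dust pullback_algebra \<and>
         cyclic_2_cocycle_on cantor_dust pullback_algebra phi"
proof (intro conjI ballI impI phi_n_tendsto subalgebra_pullback cyclic_2_cocycle_phi)
  fix f g h f' g' h'
  assume fgh: "f \<in> smooth_torus" "g \<in> smooth_torus" "h \<in> smooth_torus"
    and fgh': "f' \<in> smooth_torus" "g' \<in> smooth_torus" "h' \<in> smooth_torus"
    and eq: "pullback f = pullback f' \<and> pullback g = pullback g' \<and> pullback h = pullback h'"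
  have "2 * torus_integral f g h = phi (pullback f) (pullback g) (pullback h)"
    using fgh by (rule phi_pullback[symmetric])
  also have "\<dots> = phi (pullback f') (pullback g') (pullback h')"
    using eq by simp
  also have "\<dots> = 2 * torus_integral f' g' h'"
    using fgh' by (rule phi_pullback)
  finally show "2 * torus_integral f g h = 2 * torus_integral f' g' h'" .
qed

end
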